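(* Suppose that $\mathbb{E}(\|Z\|^2) < \infty$, that $\Sigma := \mathbb{E}(Z Z^{\top})$ is positive definite, and that $\mathbb{E} Z = \mathbf{0}$. Then \[ 2 = \liminf_{n\to\infty} \frac{L_n}{D_n} < \limsup_{n\to\infty} \frac{L_n}{D_n} = \pi, \quad \text{almost surely}. \]
   Context: Let $Z, Z_1, Z_2, \ldots$ be i.i.d. random variables in $\mathbb{R}^2$ (viewed as column vectors), and let $S_0 := \mathbf{0}$ (the origin) and $S_n := \sum_{k=1}^n Z_k$ for $n \ge 1$. Let $\mathcal{H}_n$ be the convex hull of $\{S_0, \ldots, S_n\}$, let $L_n$ be the perimeter length of $\mathcal{H}_n$, and let $D_n := \operatorname{diam}\mathcal{H}_n = \max_{0\le i,j\le n}\|S_j-S_i\|$. (If $\mathcal{H}_n$ is a line segment, its perimeter length is twice the length of the segment; in general, $L_n = \int_0^{2\pi} \max_{0\le k\le n} (S_k\cdot \mathbf{e}_\theta)\,d\theta$ with $\mathbf{e}_\theta = (\cos\theta,\sin\theta)$.) Here $\|\cdot\|$ is the Euclidean norm. Under the stated hypotheses $D_n > 0$ for all but finitely many $n$, a.s., so the ratio is eventually well defined. *)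

theory Defs
  imports "HOL-Probability.Probability"
begin

definition walk :: "(nat \<Rightarrow> 'w \<Rightarrow> real^2) \<Rightarrow> nat \<Rightarrow> 'w \<Rightarrow> real^2" where
  "walk X n \<omega> = (\<Sum>k=1..n. X k \<omega>)"

definition walk_hull :: "(nat \<Rightarrow> 'w \<Rightarrow> real^2) \<Rightarrow> nat \<Rightarrow> 'w \<Rightarrow> (real^2) set" where
  "walk_hull X n \<omega> = convex hull ((\<lambda>k. walk X k \<omega>) ` {0..n})"

(* Perimeter length of a nonempty convex polygon K in the plane. If K has nonempty interior, this
   is the sum of the lengths of its (finitely many) sides; since a side is a segment, its length is
   its diameter. A degenerate K is a segment or a point, and counts twice its length: in that case
   the sum over the edges would give the length only once. *)
definition perimeter :: "(real^2) set \<Rightarrow> real" where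
  "perimeter K = (if aff_dim K = 2 then (\<Sum>e | e edge_of K. diameter e) else 2 * diameter K)"

definition outer_square :: "real^'n \<Rightarrow> real^'n^'n" where
  "outer_square z = (columnvector z :: real^1^'n) ** transpose (columnvector z)"

definition positive_definite :: "real^'n^'n \<Rightarrow> bool" where
  "positive_definite A \<longleftrightarrow> transpose A = A \<and> (\<forall>v. v \<noteq> 0 \<longrightarrow> v \<bullet> (A *v v) > 0)"

end

theory Submission
  imports Defs
begin

text \<open>
  Both bounds on the ratio are deterministic. Cauchy's formula writes the perimeter of a convex
  polygon \<open>K\<close> as the integral over \<open>\<theta> \<in> [0, \<pi>]\<close> of the width of \<open>K\<close> in direction \<open>\<theta>\<close>
  (\<open>cauchy_perimeter_formula\<close>). The width never exceeds the diameter \<open>D\<close>, and it is at least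
  \<open>D \<bar>cos (\<theta> - \<phi>)\<bar>\<close> when a diameter of \<open>K\<close> points in direction \<open>\<phi>\<close>; integration gives
  \<open>2 D \<le> L \<le> \<pi> D\<close>. By the same formula the ratio is close to \<open>2\<close> for the hull of a set close to
  a segment, and close to \<open>\<pi>\<close> for the hull of a set close to a circle
  (\<open>ratio_near_segment\<close>, \<open>ratio_near_circle\<close>).

  It remains to see that the walk draws both shapes infinitely often. More generally, for every
  Lipschitz curve \<open>\<gamma>\<close> that starts at the origin, almost surely the range of the walk up to time
  \<open>n\<close> is, for infinitely many \<open>n\<close>, as close to a multiple of \<open>\<gamma>\<close> as desired, relative to its size
  (\<open>walk_tracks_curve\<close>). This replaces Strassen's law and the invariance principle, and it rests on
  the central limit theorem on the line only.

  Consider blocks of \<open>N\<close> steps and lengths in units of \<open>\<surd>N\<close>. The central limit theorem for the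
  projections to a line, Chebyshev's inequality and compactness of the sphere give \<open>c > 0\<close> such that,
  for every large \<open>N\<close> and every unit vector \<open>d\<close>, one block advances by at least \<open>1/2\<close> in direction
  \<open>d\<close> with probability at least \<open>c\<close>. By a maximal inequality the block can moreover be kept in a
  ball of fixed radius. Covering that ball by finitely many small balls yields a deterministic vector
  \<open>v\<close> with \<open>v \<bullet> d \<ge> 1/4\<close> such that the displacement of a block is close to \<open>v\<close> with probability
  bounded below (\<open>near_step_available\<close>). The vectors \<open>v\<close> obtained in this way depend on \<open>N\<close> and
  point only roughly in the wanted directions, but by always choosing one that pushes towards the
  current target one can follow any slowly moving target at a bounded distance (\<open>steering\<close>). If
  the target runs along a large multiple of \<open>\<gamma>\<close>, this distance is negligible, and the whole
  itinerary of \<open>m\<close> blocks is realised with probability at least a constant, uniformly in \<open>N\<close>.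

  Finally, consecutive itineraries are run with rapidly growing block lengths. They are independent,
  so almost surely infinitely many of them succeed, by the zero-one law; and each is so much longer
  than what precedes it that, by the lemma of Borel and Cantelli, the past of the walk is eventually
  negligible at its scale.
\<close>

section \<open>Cauchy's formula for the perimeter of a convex polygon\<close>

definition width :: "'a::euclidean_space \<Rightarrow> 'a set \<Rightarrow> real" where
  "width u K = diameter ((\<bullet>) u ` K)"

lemma width_le_diameter:
  assumes "bounded K" "K \<noteq> {}" "norm u \<le> 1"
  shows "width u K \<le> diameter K"
  unfolding width_def
proof (rule diameter_le)
  show "(\<bullet>) u ` K \<noteq> {} \<or> 0 \<le> diameter K" using assms by auto
  fix a b assume "a \<in> (\<bullet>) u ` K" "b \<in> (\<bullet>) u ` K"
  then obtain x y where xy: "x \<in> K" "y \<in> K" "a = u \<bullet> x" "b = u \<bullet> y" by auto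
  have "norm (a - b) = \<bar>u \<bullet> (x - y)\<bar>" by (simp add: xy inner_diff_right)
  also have "\<dots> \<le> norm u * norm (x - y)" by (rule Cauchy_Schwarz_ineq2)
  also have "\<dots> \<le> dist x y"
    using assms(3) by (simp add: dist_norm mult_left_le_one_le)
  also have "\<dots> \<le> diameter K" using assms(1) xy by (intro diameter_bounded_bound)
  finally show "norm (a - b) \<le> diameter K" .
qed

lemma abs_inner_diff_le_width:
  assumes "bounded K" "x \<in> K" "y \<in> K"
  shows "\<bar>u \<bullet> (x - y)\<bar> \<le> width u K"
proof -
  have "bounded ((\<bullet>) u ` K)"
    using assms(1) bounded_linear_inner_right by (rule bounded_linear_image)
  then have "dist (u \<bullet> x) (u \<bullet> y) \<le> width u K"
    unfolding width_def using assms by (intro diameter_bounded_bound) auto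
  then show ?thesis by (simp add: dist_norm inner_diff_right)
qed

lemma width_closed_segment: "width u (closed_segment p q) = \<bar>u \<bullet> (q - p)\<bar>"
proof -
  have "(\<bullet>) u ` closed_segment p q = closed_segment (u \<bullet> p) (u \<bullet> q)"
    by (rule closed_segment_linear_image [symmetric]) (simp add: linear_iff inner_add_right)
  then show ?thesis
    by (simp add: width_def closed_segment_eq_real_ivl inner_diff_right)
qed

lemma diameter_closed_segment: "diameter (closed_segment p (q::'a::euclidean_space)) = dist p q"
proof (rule antisym)
  show "diameter (closed_segment p q) \<le> dist p q"
  proof (rule diameter_le)
    fix x y assume xy: "x \<in> closed_segment p q" "y \<in> closed_segment p q"
    then have "closed_segment x y \<subseteq> closed_segment p q"
      by (simp add: closed_segment_subset)
    then show "norm (x - y) \<le> dist p q"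
      by (metis dist_norm dist_triangle_le segment_bound(1) xy dist_commute dist_in_closed_segment dist_decreases_closed_segment order_trans subset_closed_segment)
  qed auto
  show "dist p q \<le> diameter (closed_segment p q)"
    by (intro diameter_bounded_bound) (auto simp: bounded_closed_segment)
qed

text \<open>
  A line through the interior that avoids the vertices cuts the polygon in a segment with two
  distinct end points. An edge that meets the line does so in one point, which is a face of the
  segment and hence an end point; conversely an end point of the segment is not interior to the
  polygon, so it lies on an edge. It is not a vertex, so that edge is unique.
\<close>
lemma card_edges_meeting_line:
  fixes K :: "(real^2) set"
  assumes K: "polytope K" "aff_dim K = 2"
    and lo: "x0 \<in> K" "u \<bullet> x0 < t" and hi: "x1 \<in> K" "t < u \<bullet> x1"
    and t: "t \<notin> (\<bullet>) u ` {x. x extreme_point_of K}"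
  shows "card {e. e edge_of K \<and> t \<in> (\<bullet>) u ` e} = 2"
proof -
  define H where "H = {x. u \<bullet> x = t}"
  \<comment> \<open>A vector that spans the direction of the line.\<close>
  define p where "p = (vector [- u$2, u$1] :: real^2)"
  have u: "u \<noteq> 0" using lo(2) hi(2) by auto
  have up: "u \<bullet> p = 0" by (simp add: p_def inner_vec_def sum_2)
  have p0: "p \<noteq> 0"
    using u unfolding p_def by (auto simp: vec_eq_iff forall_2)
  have pm: "x + e *\<^sub>R p \<noteq> x - e *\<^sub>R p" if "e > 0" for x e
  proof
    assume "x + e *\<^sub>R p = x - e *\<^sub>R p"
    then have "(2 * e) *\<^sub>R p = 0" by (simp add: scaleR_2 flip: scaleR_scaleR)
    then show False using p0 that by simp
  qed
  have conv: "convex K" and comp: "compact K"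
    using K polytope_imp_convex polytope_imp_compact by auto
  have convH: "convex H" and closedH: "closed H"
    unfolding H_def by (simp_all add: convex_hyperplane closed_hyperplane)
  have intne: "interior K \<noteq> {}"
  proof -
    have "affine hull K = UNIV" using K(2) by (simp add: affine_hull_UNIV flip: aff_dim_eq_full)
    then have "interior K = rel_interior K" by (simp add: rel_interior_interior)
    moreover have "K \<noteq> {}" using K(2) by auto
    ultimately show ?thesis using conv rel_interior_eq_empty by metis
  qed
  \<comment> \<open>From an interior point one can move both ways along the line, so it is not an end point of the chord.\<close>
  have two_sided: "\<exists>e>0. x + e *\<^sub>R p \<in> K \<inter> H \<and> x - e *\<^sub>R p \<in> K \<inter> H"
    if x: "x \<in> interior K" "x \<in> H" for x
  proof -
    obtain e where e: "e > 0" "cball x e \<subseteq> K"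
      using x(1) by (auto simp: mem_interior_cball)
    have "x + (e / norm p) *\<^sub>R p \<in> cball x e" "x - (e / norm p) *\<^sub>R p \<in> cball x e"
      using e(1) p0 by (simp_all add: dist_norm)
    moreover have "x + (e / norm p) *\<^sub>R p \<in> H" "x - (e / norm p) *\<^sub>R p \<in> H"
      using x(2) up by (simp_all add: H_def inner_add_right inner_diff_right)
    ultimately show ?thesis using e p0 by (intro exI[of _ "e / norm p"]) auto
  qed
  have "\<exists>z. z \<in> interior K \<inter> H"
  proof -
    have cl: "K \<subseteq> closure (interior K)"
      using convex_closure_interior[OF conv intne] closure_subset by blast
    have "open {x. u \<bullet> x < t}" "open {x. t < u \<bullet> x}"
      by (simp_all add: open_halfspace_lt open_halfspace_gt)
    then obtain y0 y1 where "y0 \<in> interior K" "u \<bullet> y0 < t" "y1 \<in> interior K" "t < u \<bullet> y1"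
      using cl lo hi open_Int_closure_eq_empty[of "{x. u \<bullet> x < t}" "interior K"]
        open_Int_closure_eq_empty[of "{x. t < u \<bullet> x}" "interior K"] by blast
    moreover have "connected (interior K)" by (simp add: conv convex_connected)
    ultimately show ?thesis
      using connected_ivt_hyperplane[of "interior K" y0 y1 u t] by (auto simp: H_def)
  qed
  then obtain z where z: "z \<in> interior K" "z \<in> H" by auto
  have collinear: "collinear (K \<inter> H)"
  proof -
    have "aff_dim H = 1" using u by (simp add: H_def)
    then have "collinear H" by (simp add: collinear_aff_dim)
    then show ?thesis by (rule collinear_subset) simp
  qed
  have "K \<inter> H \<noteq> {}" using z interior_subset by blast
  then obtain a b where ab: "K \<inter> H = closed_segment a b"
    using compact_convex_collinear_segment[of "K \<inter> H"] collinear conv convH comp closedH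
    by (metis compact_Int_closed convex_Int)
  have "a \<noteq> b"
  proof
    assume "a = b"
    then have "K \<inter> H = {a}" using ab by simp
    moreover obtain e where "e > 0" "z + e *\<^sub>R p \<in> K \<inter> H" "z - e *\<^sub>R p \<in> K \<inter> H"
      using two_sided[OF z] by auto
    ultimately have "z + e *\<^sub>R p = z - e *\<^sub>R p" by (metis singletonD)
    then show False using pm \<open>e > 0\<close> by blast
  qed
  have ext_iff: "x extreme_point_of (K \<inter> H) \<longleftrightarrow> x \<in> {a, b}" for x
    by (simp add: ab extreme_point_of_segment)
  define E where "E = {e. e edge_of K \<and> t \<in> (\<bullet>) u ` e}"
  have seg: "\<exists>c d. e = closed_segment c d \<and> c \<noteq> d \<and> u \<bullet> c \<noteq> t \<and> u \<bullet> d \<noteq> t \<and> c \<in> K \<and> d \<in> K"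
    if e: "e edge_of K" for e
  proof -
    have face: "e face_of K" and dim: "aff_dim e = 1" using e by (auto simp: edge_of_def)
    have "polytope e" using K(1) face face_of_polytope_polytope by blast
    moreover have "collinear e" "e \<noteq> {}" using dim by (auto simp: collinear_aff_dim)
    ultimately obtain c d where cd: "e = closed_segment c d"
      using compact_convex_collinear_segment polytope_imp_compact polytope_imp_convex by metis
    have ext: "c extreme_point_of K" "d extreme_point_of K"
      using extreme_point_of_face[OF face] extreme_point_of_segment[of _ c d] cd by blast+
    then have "u \<bullet> c \<noteq> t" "u \<bullet> d \<noteq> t" "c \<in> K" "d \<in> K"
      using t by (auto simp: extreme_point_of_def)
    moreover have "c \<noteq> d" using dim cd by auto
    ultimately show ?thesis using cd by blast
  qed
  have cross: "\<exists>!x. x \<in> e \<inter> H" if e: "e \<in> E" for e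
  proof -
    obtain c d where cd: "e = closed_segment c d" "u \<bullet> c \<noteq> t"
      using seg e E_def by blast
    obtain x where x: "x \<in> e" "u \<bullet> x = t" using e by (auto simp: E_def)
    have "y = x" if y: "y \<in> e" "u \<bullet> y = t" for y
    proof -
      obtain r s where r: "x = (1 - r) *\<^sub>R c + r *\<^sub>R d" and s: "y = (1 - s) *\<^sub>R c + s *\<^sub>R d"
        using x(1) y(1) cd(1) by (auto simp: in_segment)
      have "u \<bullet> x = u \<bullet> c + r * (u \<bullet> (d - c))" "u \<bullet> y = u \<bullet> c + s * (u \<bullet> (d - c))"
        by (simp_all add: r s inner_add_right inner_diff_right algebra_simps)
      then have "r = s" using x(2) y(2) cd(2) by auto
      then show ?thesis using r s by simp
    qed
    then show ?thesis using x unfolding H_def by blast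
  qed
  define f where "f e = (THE x. x \<in> e \<inter> H)" for e
  have f: "f e \<in> e" "f e \<in> H" "e \<inter> H = {f e}" if "e \<in> E" for e
  proof -
    show *: "f e \<in> e" "f e \<in> H" using theI'[OF cross[OF that]] by (auto simp: f_def)
    show "e \<inter> H = {f e}" using cross[OF that] * by blast
  qed
  have "bij_betw f E {a, b}"
    unfolding bij_betw_def
  proof
    show "inj_on f E"
    proof (rule inj_onI)
      have sub: "e \<subseteq> e'" if e: "e \<in> E" "e' \<in> E" "f e = f e'" for e e'
      proof -
        obtain c d where cd: "e = closed_segment c d" "u \<bullet> c \<noteq> t" "u \<bullet> d \<noteq> t" "c \<in> K" "d \<in> K"
          using seg e(1) unfolding E_def by blast
        have "f e \<in> open_segment c d"
          using f(1,2)[OF e(1)] cd by (auto simp: open_segment_def H_def)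
        moreover have "f e \<in> e'" using f[OF e(2)] e(3) by simp
        moreover have "e' face_of K" using e(2) by (auto simp: E_def edge_of_def)
        ultimately have "c \<in> e'" "d \<in> e'"
          using face_ofD[of e' K "f e" c d] cd(4,5) by simp_all
        moreover have "convex e'" using \<open>e' face_of K\<close> face_of_imp_convex by blast
        ultimately show ?thesis using cd(1) by (simp add: closed_segment_subset)
      qed
      fix e e' assume "e \<in> E" "e' \<in> E" "f e = f e'"
      then show "e = e'" using sub[of e e'] sub[of e' e] by auto
    qed
    show "f ` E = {a, b}"
    proof
      show "f ` E \<subseteq> {a, b}"
      proof (rule image_subsetI)
        fix e assume e: "e \<in> E"
        have "e \<inter> H face_of K \<inter> H"
          using e convH by (intro face_of_slice) (auto simp: E_def edge_of_def)
        then show "f e \<in> {a, b}"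
          using f(3)[OF e] ext_iff by (simp add: face_of_singleton)
      qed
      show "{a, b} \<subseteq> f ` E"
      proof
        fix x assume "x \<in> {a, b}"
        then have ext: "x extreme_point_of (K \<inter> H)" using ext_iff by simp
        then have xKH: "x \<in> K" "x \<in> H" by (auto simp: extreme_point_of_def)
        have "x \<notin> interior K"
        proof
          assume "x \<in> interior K"
          then obtain e where e: "e > 0" "x + e *\<^sub>R p \<in> K \<inter> H" "x - e *\<^sub>R p \<in> K \<inter> H"
            using two_sided xKH by blast
          have "x = midpoint (x + e *\<^sub>R p) (x - e *\<^sub>R p)"
            by (simp add: midpoint_def scaleR_2[symmetric])
          moreover have "x + e *\<^sub>R p \<noteq> x - e *\<^sub>R p"
            using pm e(1) by blast
          ultimately have "x \<in> open_segment (x + e *\<^sub>R p) (x - e *\<^sub>R p)"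
            by (metis midpoint_in_open_segment)
          then show False using ext e by (auto simp: extreme_point_of_def)
        qed
        then have "x \<in> rel_frontier K"
          using intne xKH comp compact_imp_closed rel_interior_nonempty_interior
          by (metis DiffI closure_closed rel_frontier_def)
        then obtain e where "e facet_of K" "x \<in> e"
          using rel_frontier_of_polyhedron polytope_imp_polyhedron K(1) by blast
        then have "e edge_of K" using K(2) by (simp add: facet_of_def edge_of_def)
        then have "e \<in> E" using \<open>x \<in> e\<close> xKH by (auto simp: E_def H_def)
        then show "x \<in> f ` E" using f(3) \<open>x \<in> e\<close> xKH by blast
      qed
    qed
  qed
  then have "card E = card {a, b}" by (rule bij_betw_same_card)
  then show ?thesis using \<open>a \<noteq> b\<close> by (simp add: E_def)
qed

lemma has_integral_indicator_segment_image:
  fixes S :: "real set"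
  assumes "compact S" "connected S"
  shows "(indicator S has_integral diameter S) UNIV"
proof (cases "S = {}")
  case True
  then show ?thesis using has_integral_0[of UNIV] by (simp add: fun_eq_iff cong: has_integral_cong)
next
  case False
  then obtain a b where ab: "S = {a..b}" "a \<le> b"
    using connected_compact_interval_1[of S] assms
    by (metis atLeastatMost_empty_iff cbox_interval)
  have "((\<lambda>x. 1::real) has_integral (b - a)) {a..b}"
    using has_integral_const_real[of "1::real" a b] ab(2) by simp
  then have "((\<lambda>x. if x \<in> {a..b} then 1 else 0) has_integral (b - a)) UNIV"
    by (simp only: has_integral_restrict_UNIV)
  moreover have "indicator S = (\<lambda>x. if x \<in> {a..b} then 1 else 0::real)"
    by (auto simp: ab indicator_def)
  ultimately show ?thesis using ab by simp
qed

text \<open>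
  Projected to a line, the boundary of a polygon covers almost every point of the projection of the
  polygon exactly twice. Integrating the indicator functions of the projected edges turns this count
  into a statement about lengths.
\<close>
lemma sum_width_edges:
  fixes K :: "(real^2) set"
  assumes K: "polytope K" "aff_dim K = 2"
  shows "(\<Sum>e | e edge_of K. width u e) = 2 * width u K"
proof -
  let ?u = "(\<bullet>) u"
  have cont: "continuous_on S ?u" for S by (intro continuous_intros)
  have compconn: "compact (?u ` S)" "connected (?u ` S)" if "polytope S" for S
    using that by (meson compact_continuous_image connected_continuous_image cont
        polytope_imp_compact convex_connected polytope_imp_convex)+
  define E where "E = {e. e edge_of K}"
  have finE: "finite E"
    unfolding E_def edge_of_def using finite_polytope_faces[OF K(1)]
    by (rule rev_finite_subset) auto
  have poly: "polytope e" if "e \<in> E" for e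
    using that K(1) face_of_polytope_polytope by (auto simp: E_def edge_of_def)
  have edges: "((\<lambda>t. \<Sum>e\<in>E. indicator (?u ` e) t) has_integral (\<Sum>e\<in>E. width u e)) UNIV"
    unfolding width_def
    by (intro has_integral_sum finE has_integral_indicator_segment_image compconn poly)
  have whole: "((\<lambda>t. 2 * indicator (?u ` K) t) has_integral (2 * width u K)) UNIV"
    unfolding width_def
    by (intro has_integral_mult_right has_integral_indicator_segment_image compconn K)
  obtain \<alpha> \<beta> where ab: "?u ` K = {\<alpha>..\<beta>}"
    using connected_compact_interval_1[of "?u ` K"] compconn[OF K(1)] by auto
  \<comment> \<open>The finitely many values at which the count of edges may fail: the vertices and the two ends.\<close>
  define T where "T = insert \<alpha> (insert \<beta> (?u ` {x. x extreme_point_of K}))"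
  have "finite {x. x extreme_point_of K}"
    using K(1) by (simp add: finite_polyhedron_extreme_points polytope_imp_polyhedron)
  then have finT: "finite T" by (simp add: T_def)
  have eq: "2 * indicator (?u ` K) t = (\<Sum>e\<in>E. indicator (?u ` e) t :: real)" if "t \<in> UNIV - T" for t
  proof -
    have "(\<Sum>e\<in>E. indicator (?u ` e) t :: real) = card {e \<in> E. t \<in> ?u ` e}"
      using finE by (simp add: indicator_def sum.If_cases Int_def)
    also have "{e \<in> E. t \<in> ?u ` e} = {e. e edge_of K \<and> t \<in> ?u ` e}" by (simp add: E_def)
    also have "real (card \<dots>) = 2 * indicator (?u ` K) t"
    proof (cases "t \<in> ?u ` K")
      case True
      then have t: "\<alpha> < t" "t < \<beta>" using that ab unfolding T_def by force+
      then have "\<alpha> \<in> ?u ` K" "\<beta> \<in> ?u ` K" using ab by auto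
      then obtain x0 x1 where "x0 \<in> K" "u \<bullet> x0 = \<alpha>" "x1 \<in> K" "u \<bullet> x1 = \<beta>" by auto
      then show ?thesis
        using card_edges_meeting_line[OF K, of x0 u t x1] t that True by (simp add: T_def)
    next
      case False
      then have "{e. e edge_of K \<and> t \<in> ?u ` e} = {}"
        using edge_of_imp_subset by blast
      then show ?thesis using False by (simp only:) simp
    qed
    finally show ?thesis by simp
  qed
  have "((\<lambda>t. 2 * indicator (?u ` K) t) has_integral (\<Sum>e\<in>E. width u e)) UNIV"
    by (rule has_integral_spike_finite[OF finT eq edges])
  from has_integral_unique[OF this whole] show ?thesis by (simp add: E_def)
qed

definition direction :: "real \<Rightarrow> real^2" where
  "direction \<theta> = vector [cos \<theta>, sin \<theta>]"

lemma norm_direction [simp]: "norm (direction \<theta>) = 1"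
  by (simp add: direction_def norm_vec_def L2_set_def sum_2)

text \<open>
  The average length of the projections of a vector. After a change of sign the angle \<open>\<phi>\<close> of the
  vector lies in \<open>[-\<pi>/2, \<pi>/2]\<close>, and the inner product \<open>r cos (\<theta> - \<phi>)\<close> changes sign on \<open>[0, \<pi>]\<close>
  only at \<open>\<phi> + \<pi>/2\<close>.
\<close>
lemma has_integral_abs_inner_direction:
  "((\<lambda>\<theta>. \<bar>direction \<theta> \<bullet> v\<bar>) has_integral 2 * norm v) {0..pi}"
proof -
  have *: "((\<lambda>\<theta>. \<bar>direction \<theta> \<bullet> v\<bar>) has_integral 2 * norm v) {0..pi}" if v: "v$1 \<ge> 0" for v
  proof (cases "v = 0")
    case False
    define r where "r = norm v"
    have "r > 0" using False by (simp add: r_def)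
    moreover have "r\<^sup>2 = (v$1)\<^sup>2 + (v$2)\<^sup>2"
      unfolding r_def power2_norm_eq_inner by (simp add: inner_vec_def sum_2 power2_eq_square)
    ultimately have r: "r > 0" "r\<^sup>2 = (v$1)\<^sup>2 + (v$2)\<^sup>2" .
    define \<phi> where "\<phi> = arcsin (v$2 / r)"
    have "(v$2)\<^sup>2 \<le> r\<^sup>2" using r by simp
    then have abs: "\<bar>v$2\<bar> \<le> r" using r(1) by (simp add: abs_le_square_iff[symmetric])
    then have bnd: "-1 \<le> v$2 / r" "v$2 / r \<le> 1" using r(1) by (auto simp: field_simps)
    have \<phi>: "- (pi/2) \<le> \<phi>" "\<phi> \<le> pi/2"
      using arcsin_bounded[OF bnd] by (auto simp: \<phi>_def)
    have sin: "v$2 = r * sin \<phi>" using bnd r(1) by (simp add: \<phi>_def)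
    have cos: "v$1 = r * cos \<phi>"
    proof -
      have "(v$1)\<^sup>2 = (r * cos \<phi>)\<^sup>2"
        using r(2) sin by (simp add: power_mult_distrib cos_squared_eq algebra_simps)
      moreover have "cos \<phi> \<ge> 0" using \<phi> by (intro cos_ge_zero) auto
      ultimately show ?thesis using v r(1) by (simp add: power2_eq_iff_nonneg)
    qed
    have inner: "direction \<theta> \<bullet> v = r * cos (\<theta> - \<phi>)" for \<theta>
      by (simp add: direction_def inner_vec_def sum_2 sin cos cos_diff algebra_simps)
    have antideriv: "((\<lambda>\<theta>. r * cos (\<theta> - \<phi>)) has_integral (r * sin (y - \<phi>) - r * sin (x - \<phi>))) {x..y}"
      if "x \<le> y" for x y
      using that by (intro fundamental_theorem_of_calculus)
        (auto intro!: derivative_eq_intros simp flip: has_real_derivative_iff_has_vector_derivative)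
    have "((\<lambda>\<theta>. \<bar>direction \<theta> \<bullet> v\<bar>) has_integral (r + r * sin \<phi>)) {0..\<phi> + pi/2}"
    proof (rule has_integral_eq)
      show "((\<lambda>\<theta>. r * cos (\<theta> - \<phi>)) has_integral (r + r * sin \<phi>)) {0..\<phi> + pi/2}"
        using antideriv[of 0 "\<phi> + pi/2"] \<phi> by simp
      show "r * cos (\<theta> - \<phi>) = \<bar>direction \<theta> \<bullet> v\<bar>" if "\<theta> \<in> {0..\<phi> + pi/2}" for \<theta>
      proof -
        have "cos (\<theta> - \<phi>) \<ge> 0" using that \<phi> by (intro cos_ge_zero) auto
        then show ?thesis using r(1) by (simp add: inner)
      qed
    qed
    moreover have "((\<lambda>\<theta>. \<bar>direction \<theta> \<bullet> v\<bar>) has_integral (r - r * sin \<phi>)) {\<phi> + pi/2..pi}"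
    proof (rule has_integral_eq)
      have "((\<lambda>\<theta>. r * cos (\<theta> - \<phi>)) has_integral (r * sin \<phi> - r)) {\<phi> + pi/2..pi}"
        using antideriv[of "\<phi> + pi/2" pi] \<phi> by simp
      from has_integral_neg[OF this]
      show "((\<lambda>\<theta>. - (r * cos (\<theta> - \<phi>))) has_integral (r - r * sin \<phi>)) {\<phi> + pi/2..pi}"
        by simp
      show "- (r * cos (\<theta> - \<phi>)) = \<bar>direction \<theta> \<bullet> v\<bar>" if "\<theta> \<in> {\<phi> + pi/2..pi}" for \<theta>
      proof -
        have "cos (pi - (\<theta> - \<phi>)) \<ge> 0" using that \<phi> by (intro cos_ge_zero) auto
        then show ?thesis using r(1) by (simp add: inner abs_mult)
      qed
    qed
    ultimately have "((\<lambda>\<theta>. \<bar>direction \<theta> \<bullet> v\<bar>) has_integral (r + r * sin \<phi> + (r - r * sin \<phi>))) {0..pi}"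
      using \<phi> by (intro has_integral_combine[of 0 "\<phi> + pi/2" pi]) auto
    then show ?thesis by (simp add: r_def)
  qed simp
  show ?thesis
  proof (cases "v$1 \<ge> 0")
    case False
    then show ?thesis using *[of "-v"] by simp
  qed (rule *)
qed

text \<open>
  In the nondegenerate case the widths of the edges sum to twice the width of the polygon, and each
  edge contributes twice its length to the integral, so the two factors cancel. In the degenerate
  case the convention that a segment has twice its length as perimeter is exactly what makes the same
  formula hold.
\<close>
theorem cauchy_perimeter_formula:
  fixes K :: "(real^2) set"
  assumes K: "polytope K" "K \<noteq> {}"
  shows "((\<lambda>\<theta>. width (direction \<theta>) K) has_integral perimeter K) {0..pi}"
proof (cases "aff_dim K = 2")
  case True
  have seg: "((\<lambda>\<theta>. width (direction \<theta>) e) has_integral 2 * diameter e) {0..pi}"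
    if "e edge_of K" for e
  proof -
    have "e face_of K" "aff_dim e = 1" using that by (auto simp: edge_of_def)
    then have "polytope e" "collinear e" "e \<noteq> {}"
      using K(1) face_of_polytope_polytope by (auto simp: collinear_aff_dim)
    then obtain c d where "e = closed_segment c d"
      using compact_convex_collinear_segment polytope_imp_compact polytope_imp_convex by metis
    then show ?thesis
      using has_integral_abs_inner_direction[of "d - c"]
      by (simp add: width_closed_segment diameter_closed_segment dist_norm norm_minus_commute)
  qed
  have "finite {e. e edge_of K}"
    unfolding edge_of_def using finite_polytope_faces[OF K(1)] by (rule rev_finite_subset) auto
  then have "((\<lambda>\<theta>. \<Sum>e | e edge_of K. width (direction \<theta>) e) has_integral
      (\<Sum>e | e edge_of K. 2 * diameter e)) {0..pi}"
    using seg by (intro has_integral_sum) auto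
  then have "((\<lambda>\<theta>. 2 * width (direction \<theta>) K) has_integral 2 * perimeter K) {0..pi}"
    using True by (simp add: sum_width_edges[OF K(1) True] perimeter_def sum_distrib_left)
  from has_integral_mult_right[OF this, of "1/2"] show ?thesis by simp
next
  case False
  have "aff_dim K \<le> 2" using aff_dim_le_DIM[of K] by simp
  then have "collinear K" using False by (simp add: collinear_aff_dim)
  then obtain c d where "K = closed_segment c d"
    using K compact_convex_collinear_segment polytope_imp_compact polytope_imp_convex by metis
  then show ?thesis
    using has_integral_abs_inner_direction[of "d - c"] False
    by (simp add: perimeter_def width_closed_segment diameter_closed_segment dist_norm norm_minus_commute)
qed

lemma perimeter_le_pi_diameter:
  assumes "polytope K" "K \<noteq> {}"
  shows "perimeter K \<le> pi * diameter K"
proof (rule has_integral_le[OF cauchy_perimeter_formula[OF assms]])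
  show "((\<lambda>_. diameter K) has_integral pi * diameter K) {0..pi}"
    using has_integral_const_real[of "diameter K" 0 pi] by simp
qed (use assms in \<open>auto intro!: width_le_diameter polytope_imp_bounded\<close>)

lemma two_diameter_le_perimeter:
  assumes "polytope K" "K \<noteq> {}"
  shows "2 * diameter K \<le> perimeter K"
proof -
  obtain x y where xy: "x \<in> K" "y \<in> K" "dist x y = diameter K"
    using diameter_compact_attained[OF polytope_imp_compact] assms by blast
  have "2 * norm (x - y) \<le> perimeter K"
    using assms xy
    by (intro has_integral_le[OF has_integral_abs_inner_direction cauchy_perimeter_formula])
      (auto intro!: abs_inner_diff_le_width polytope_imp_bounded)
  then show ?thesis using xy by (simp add: dist_norm)
qed

section \<open>Hulls of sets near a segment or a circle\<close>

text \<open>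
  The Hausdorff distance between \<open>A\<close> and the copy of the curve scaled by \<open>s\<close> is at most \<open>\<rho> s\<close>; the
  error is measured relative to the scale because the ratio of perimeter to diameter is scale
  invariant.
\<close>
definition tracks :: "real \<Rightarrow> real \<Rightarrow> (real \<Rightarrow> 'a::real_normed_vector) \<Rightarrow> 'a set \<Rightarrow> bool" where
  "tracks \<rho> s \<gamma> A \<longleftrightarrow>
     (\<forall>x\<in>A. \<exists>t\<in>{0..1}. norm (x - s *\<^sub>R \<gamma> t) \<le> \<rho> * s) \<and>
     (\<forall>t\<in>{0..1}. \<exists>x\<in>A. norm (x - s *\<^sub>R \<gamma> t) \<le> \<rho> * s)"

text \<open>
  A ball of radius \<open>b\<close> around a point of \<open>A\<close> contains \<open>A\<close> and therefore its hull; so a ball of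
  radius \<open>b\<close> around any point of the hull contains \<open>A\<close>, and again its hull.
\<close>
lemma diameter_convex_hull_le:
  fixes A :: "'a::real_normed_vector set"
  assumes "A \<noteq> {}" "\<And>x y. x \<in> A \<Longrightarrow> y \<in> A \<Longrightarrow> norm (x - y) \<le> b"
  shows "diameter (convex hull A) \<le> b"
proof (rule diameter_le)
  show "convex hull A \<noteq> {} \<or> 0 \<le> b" using assms(1) by simp
  have hull: "convex hull A \<subseteq> cball x b" if "\<And>y. y \<in> A \<Longrightarrow> norm (x - y) \<le> b" for x
    using that by (intro hull_minimal) (auto simp: dist_norm)
  fix x y assume xy: "x \<in> convex hull A" "y \<in> convex hull A"
  have "norm (x - z) \<le> b" if "z \<in> A" for z
    using hull[of z] assms(2) that xy(1) by (auto simp: dist_norm norm_minus_commute)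
  then show "norm (x - y) \<le> b"
    using hull[of x] xy(2) by (auto simp: dist_norm)
qed

lemma width_convex_hull_le:
  assumes "A \<noteq> {}" "\<And>x y. x \<in> A \<Longrightarrow> y \<in> A \<Longrightarrow> \<bar>u \<bullet> (x - y)\<bar> \<le> b"
  shows "width u (convex hull A) \<le> b"
proof -
  have "linear ((\<bullet>) u)" by (simp add: linear_iff inner_add_right)
  then have "width u (convex hull A) = diameter (convex hull ((\<bullet>) u ` A))"
    unfolding width_def by (simp add: convex_hull_linear_image)
  also have "\<dots> \<le> b"
    using assms by (intro diameter_convex_hull_le) (auto simp: inner_diff_right)
  finally show ?thesis .
qed

lemma inner_diff_le_approx:
  fixes u :: "'a::real_inner"
  assumes "norm u \<le> 1" "norm (x - x') \<le> \<epsilon>" "norm (y - y') \<le> \<epsilon>"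
  shows "\<bar>u \<bullet> (x - y) - u \<bullet> (x' - y')\<bar> \<le> 2 * \<epsilon>"
proof -
  have bound: "\<bar>u \<bullet> z\<bar> \<le> \<epsilon>" if "norm z \<le> \<epsilon>" for z
  proof -
    have "\<bar>u \<bullet> z\<bar> \<le> norm u * norm z" by (rule Cauchy_Schwarz_ineq2)
    also have "\<dots> \<le> norm z" using assms(1) by (simp add: mult_left_le_one_le)
    finally show ?thesis using that by simp
  qed
  have "u \<bullet> (x - y) - u \<bullet> (x' - y') = u \<bullet> (x - x') - u \<bullet> (y - y')"
    by (simp add: inner_diff_right)
  then show ?thesis using bound[OF assms(2)] bound[OF assms(3)] by linarith
qed

lemma norm_diff_le_approx:
  fixes x y :: "'a::real_normed_vector"
  assumes "norm (x - x') \<le> \<epsilon>" "norm (y - y') \<le> \<epsilon>"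
  shows "\<bar>norm (x - y) - norm (x' - y')\<bar> \<le> 2 * \<epsilon>"
proof -
  have "\<bar>norm (x - y) - norm (x' - y')\<bar> \<le> norm ((x - x') - (y - y'))"
    using norm_triangle_ineq3[of "x - y" "x' - y'"] by (simp add: algebra_simps)
  also have "\<dots> \<le> 2 * \<epsilon>"
    using norm_triangle_ineq4[of "x - x'" "y - y'"] assms by linarith
  finally show ?thesis .
qed

text \<open>
  The width in direction \<open>u\<close> exceeds that of the segment by at most twice the error, while the
  diameter falls short of its length by at most as much.
\<close>
lemma ratio_near_segment:
  fixes A :: "(real^2) set"
  assumes A: "finite A" "tracks \<rho> s (\<lambda>t. t *\<^sub>R d) A" and d: "norm d = 1"
    and s: "0 < s" and \<rho>: "\<rho> < 1/2"
  shows "0 < diameter (convex hull A)"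
    and "perimeter (convex hull A) / diameter (convex hull A) \<le> (2 + 2 * pi * \<rho>) / (1 - 2 * \<rho>)"
proof -
  let ?K = "convex hull A"
  obtain x y where xy: "x \<in> A" "norm (x - s *\<^sub>R 1 *\<^sub>R d) \<le> \<rho> * s"
      "y \<in> A" "norm (y - s *\<^sub>R 0 *\<^sub>R d) \<le> \<rho> * s"
    using A(2) unfolding tracks_def by (metis atLeastAtMost_iff order_refl zero_le_one)
  have ne: "A \<noteq> {}" using xy by auto
  have poly: "polytope ?K" "?K \<noteq> {}" using A(1) ne by (auto simp: polytope_convex_hull)
  have \<rho>s: "0 \<le> \<rho> * s" using xy(2) norm_ge_zero order_trans by blast
  have "s * (1 - 2 * \<rho>) \<le> norm (x - y)"
    using norm_diff_le_approx[OF xy(2,4)] s d by (simp add: algebra_simps)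
  also have "\<dots> \<le> diameter ?K"
    using xy polytope_imp_bounded[OF poly(1)]
    by (metis dist_norm diameter_bounded_bound hull_inc)
  finally have diam: "s * (1 - 2 * \<rho>) \<le> diameter ?K" .
  moreover have pos: "0 < s * (1 - 2 * \<rho>)" using s \<rho> by simp
  ultimately show "0 < diameter ?K" by simp
  have width: "width u ?K \<le> s * \<bar>u \<bullet> d\<bar> + 2 * \<rho> * s" if u: "norm u \<le> 1" for u
  proof (rule width_convex_hull_le[OF ne])
    fix x y assume "x \<in> A" "y \<in> A"
    then obtain t t' where t: "t \<in> {0..1}" "norm (x - s *\<^sub>R t *\<^sub>R d) \<le> \<rho> * s"
      and t': "t' \<in> {0..1}" "norm (y - s *\<^sub>R t' *\<^sub>R d) \<le> \<rho> * s"
      using A(2) unfolding tracks_def by meson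
    have "\<bar>t - t'\<bar> * (s * \<bar>u \<bullet> d\<bar>) \<le> 1 * (s * \<bar>u \<bullet> d\<bar>)"
      using t(1) t'(1) s by (intro mult_right_mono) auto
    moreover have "\<bar>u \<bullet> (s *\<^sub>R t *\<^sub>R d - s *\<^sub>R t' *\<^sub>R d)\<bar> = \<bar>t - t'\<bar> * (s * \<bar>u \<bullet> d\<bar>)"
    proof -
      have "s *\<^sub>R t *\<^sub>R d - s *\<^sub>R t' *\<^sub>R d = ((t - t') * s) *\<^sub>R d"
        by (simp add: algebra_simps)
      then show ?thesis using s by (simp add: abs_mult)
    qed
    ultimately show "\<bar>u \<bullet> (x - y)\<bar> \<le> s * \<bar>u \<bullet> d\<bar> + 2 * \<rho> * s"
      using inner_diff_le_approx[OF u t(2) t'(2)] by linarith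
  qed
  have "perimeter ?K \<le> s * (2 * norm d) + 2 * \<rho> * s * pi"
  proof (rule has_integral_le[OF cauchy_perimeter_formula[OF poly]])
    have "((\<lambda>_. 2 * \<rho> * s) has_integral 2 * \<rho> * s * pi) {0..pi}"
      using has_integral_const_real[of "2 * \<rho> * s" 0 pi] by (simp add: mult.commute)
    then show "((\<lambda>\<theta>. s * \<bar>direction \<theta> \<bullet> d\<bar> + 2 * \<rho> * s) has_integral
        s * (2 * norm d) + 2 * \<rho> * s * pi) {0..pi}"
      by (intro has_integral_add has_integral_mult_right has_integral_abs_inner_direction)
  qed (simp add: width)
  also have "\<dots> = s * (2 + 2 * pi * \<rho>)" by (simp add: d algebra_simps)
  finally have "perimeter ?K \<le> s * (2 + 2 * pi * \<rho>)" .
  moreover have "0 \<le> s * (2 + 2 * pi * \<rho>)" using \<rho>s s by (simp add: algebra_simps)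
  ultimately have "perimeter ?K / diameter ?K \<le> (s * (2 + 2 * pi * \<rho>)) / (s * (1 - 2 * \<rho>))"
    using diam pos by (intro frac_le)
  then show "perimeter ?K / diameter ?K \<le> (2 + 2 * pi * \<rho>) / (1 - 2 * \<rho>)"
    using s by simp
qed

text \<open>
  The hull has width almost \<open>2 s\<close> in every direction, because antipodal points of the circle are
  almost attained, while two of its points are never much further than \<open>2 s\<close> apart. The circle is
  translated so that it starts at the origin.
\<close>
lemma ratio_near_circle:
  fixes A :: "(real^2) set"
  assumes A: "finite A" "tracks \<rho> s (\<lambda>t. direction (2 * pi * t) - direction 0) A"
    and s: "0 < s" and \<rho>: "\<rho> < 1"
  shows "pi * (1 - \<rho>) / (1 + \<rho>) \<le> perimeter (convex hull A) / diameter (convex hull A)"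
proof -
  let ?K = "convex hull A"
  let ?\<gamma> = "\<lambda>t. direction (2 * pi * t) - direction 0"
  obtain x0 where x0: "x0 \<in> A" "norm (x0 - s *\<^sub>R ?\<gamma> 0) \<le> \<rho> * s"
    using A(2) unfolding tracks_def by (metis atLeastAtMost_iff order_refl zero_le_one)
  have ne: "A \<noteq> {}" using x0 by auto
  have poly: "polytope ?K" "?K \<noteq> {}" using A(1) ne by (auto simp: polytope_convex_hull)
  have bdd: "bounded ?K" using poly(1) by (rule polytope_imp_bounded)
  have \<rho>0: "0 \<le> \<rho>" using order_trans[OF norm_ge_zero x0(2)] s by (simp add: zero_le_mult_iff)
  have diam: "diameter ?K \<le> 2 * s * (1 + \<rho>)"
  proof (rule diameter_convex_hull_le[OF ne])
    fix x y assume "x \<in> A" "y \<in> A"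
    then obtain t t' where t: "norm (x - s *\<^sub>R ?\<gamma> t) \<le> \<rho> * s"
      and t': "norm (y - s *\<^sub>R ?\<gamma> t') \<le> \<rho> * s"
      using A(2) unfolding tracks_def by meson
    have "norm (s *\<^sub>R ?\<gamma> t - s *\<^sub>R ?\<gamma> t') = s * norm (direction (2 * pi * t) - direction (2 * pi * t'))"
      using s by (simp flip: scaleR_diff_right)
    also have "\<dots> \<le> s * 2"
      using s norm_triangle_ineq4[of "direction (2 * pi * t)" "direction (2 * pi * t')"]
      by (intro mult_left_mono) auto
    finally show "norm (x - y) \<le> 2 * s * (1 + \<rho>)"
      using norm_diff_le_approx[OF t t'] by (simp add: algebra_simps)
  qed
  have width: "2 * s * (1 - \<rho>) \<le> width (direction \<theta>) ?K" if \<theta>: "\<theta> \<in> {0..pi}" for \<theta>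
  proof -
    have "\<theta> / (2 * pi) \<in> {0..1}" "(\<theta> + pi) / (2 * pi) \<in> {0..1}" using \<theta> by auto
    then obtain x y where x: "x \<in> A" "norm (x - s *\<^sub>R ?\<gamma> (\<theta> / (2 * pi))) \<le> \<rho> * s"
      and y: "y \<in> A" "norm (y - s *\<^sub>R ?\<gamma> ((\<theta> + pi) / (2 * pi))) \<le> \<rho> * s"
      using A(2) unfolding tracks_def by meson
    define a b where "a = direction \<theta>" and "b = direction 0"
    have args: "2 * pi * (\<theta> / (2 * pi)) = \<theta>" "2 * pi * ((\<theta> + pi) / (2 * pi)) = \<theta> + pi"
      by simp_all
    have antipode: "direction (\<theta> + pi) = - a"
      by (simp add: a_def direction_def vec_eq_iff forall_2)
    have "s *\<^sub>R (a - b) - s *\<^sub>R (- a - b) = (2 * s) *\<^sub>R a"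
      by (simp only: mult_2 scaleR_add_left scaleR_diff_right scaleR_minus_right) simp
    moreover have "a \<bullet> a = 1" by (simp add: a_def dot_square_norm)
    ultimately have "a \<bullet> (s *\<^sub>R (a - b) - s *\<^sub>R (- a - b)) = 2 * s" by simp
    moreover have "\<bar>a \<bullet> (x - y) - a \<bullet> (s *\<^sub>R (a - b) - s *\<^sub>R (- a - b))\<bar> \<le> 2 * (\<rho> * s)"
    proof (rule inner_diff_le_approx)
      show "norm (x - s *\<^sub>R (a - b)) \<le> \<rho> * s"
        using x(2) unfolding args a_def b_def .
      show "norm (y - s *\<^sub>R (- a - b)) \<le> \<rho> * s"
        using y(2) unfolding args antipode b_def .
    qed (simp add: a_def)
    moreover have "2 * s * (1 - \<rho>) = 2 * s - 2 * (\<rho> * s)" by (simp add: algebra_simps)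
    ultimately have "2 * s * (1 - \<rho>) \<le> a \<bullet> (x - y)" by linarith
    then have "2 * s * (1 - \<rho>) \<le> \<bar>direction \<theta> \<bullet> (x - y)\<bar>"
      unfolding a_def by linarith
    also have "\<dots> \<le> width (direction \<theta>) ?K"
      using x(1) y(1) by (intro abs_inner_diff_le_width bdd hull_inc)
    finally show ?thesis .
  qed
  have "pi * (2 * s * (1 - \<rho>)) \<le> perimeter ?K"
  proof (rule has_integral_le[OF _ cauchy_perimeter_formula[OF poly] width])
    show "((\<lambda>_. 2 * s * (1 - \<rho>)) has_integral pi * (2 * s * (1 - \<rho>))) {0..pi}"
      using has_integral_const_real[of "2 * s * (1 - \<rho>)" 0 pi] by simp
  qed
  moreover have dpos: "0 < diameter ?K"
  proof -
    have "0 < 2 * s * (1 - \<rho>)" using s \<rho> by simp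
    also have "\<dots> \<le> width (direction 0) ?K" using width[of 0] by simp
    also have "\<dots> \<le> diameter ?K" using bdd poly(2) by (intro width_le_diameter) auto
    finally show ?thesis .
  qed
  ultimately have "pi * (2 * s * (1 - \<rho>)) / (2 * s * (1 + \<rho>)) \<le> perimeter ?K / diameter ?K"
  proof (intro frac_le)
    show "0 \<le> perimeter ?K" using two_diameter_le_perimeter[OF poly] dpos by linarith
  qed (use diam dpos in auto)
  moreover have "pi * (2 * s * (1 - \<rho>)) / (2 * s * (1 + \<rho>)) = pi * (1 - \<rho>) / (1 + \<rho>)"
    using s \<rho>0 by (simp add: divide_simps)
  ultimately show ?thesis by simp
qed

section \<open>Following a moving target with crude moves\<close>

text \<open>
  The greedy strategy: always choose the move that pushes towards the target. With \<open>r\<close> the current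
  distance to the target, a move changes the squared distance to at most \<open>r\<^sup>2 - 2 a r + R\<^sup>2\<close>. If
  \<open>r \<ge> R\<^sup>2 / a\<close>, this is a gain of at least \<open>a / 2\<close> in distance, which makes up for the motion of the
  target; from a smaller distance, a single move cannot lead far away.
\<close>
lemma steering:
  fixes V :: "'a::real_inner set" and x :: "nat \<Rightarrow> 'a"
  assumes bound: "\<And>v. v \<in> V \<Longrightarrow> norm v \<le> R"
    and push: "\<And>d. \<exists>v\<in>V. a * norm d \<le> v \<bullet> d" and a: "0 < a"
    and x0: "x 0 = 0" and slow: "\<And>i. norm (x (Suc i) - x i) \<le> a / 2"
  shows "\<exists>v. (\<forall>i. v i \<in> V) \<and> (\<forall>i. norm ((\<Sum>l<i. v l) - x i) \<le> R\<^sup>2 / a + R + a)"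
proof -
  define C where "C = R\<^sup>2 / a + R + a"
  have "V \<noteq> {}" using push by auto
  then have R: "0 \<le> R" using bound norm_ge_zero order_trans by blast
  have aC: "R\<^sup>2 \<le> a * C" using a R by (simp add: C_def field_simps)
  have RC: "R + a / 2 \<le> C" using a R by (simp add: C_def)
  obtain f where f: "\<And>d. f d \<in> V" "\<And>d. a * norm d \<le> f d \<bullet> d" using push by metis
  define y where "y = rec_nat 0 (\<lambda>i y. y + f (x i - y))"
  have y: "y 0 = 0" "y (Suc i) = y i + f (x i - y i)" for i by (simp_all add: y_def)
  have close: "norm (y i - x i) \<le> C" for i
  proof (induction i)
    case 0
    then show ?case using y x0 RC R a by simp
  next
    case (Suc i)
    define r where "r = norm (y i - x i)"
    define v where "v = f (x i - y i)"
    have v: "norm v \<le> R" "a * r \<le> v \<bullet> (x i - y i)"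
      using bound f[of "x i - y i"] by (simp_all add: v_def r_def norm_minus_commute)
    have "(norm (y i + v - x i))\<^sup>2 = r\<^sup>2 - 2 * (v \<bullet> (x i - y i)) + (norm v)\<^sup>2"
      unfolding r_def power2_norm_eq_inner by (simp add: algebra_simps inner_commute)
    also have "\<dots> \<le> r\<^sup>2 - 2 * (a * r) + R\<^sup>2"
      using v power_mono[OF v(1), of 2] by simp
    also have "\<dots> \<le> (C - a / 2)\<^sup>2"
    proof (cases "r \<le> 2 * a")
      case True
      then have "r * (r - 2 * a) \<le> 0"
        by (intro mult_nonneg_nonpos) (auto simp: r_def)
      moreover have "R\<^sup>2 \<le> (C - a / 2)\<^sup>2" using RC R by (intro power_mono) auto
      ultimately show ?thesis by (simp add: power2_eq_square algebra_simps)
    next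
      case False
      have "r \<le> C" using Suc by (simp add: r_def)
      then have "r * (r - 2 * a) \<le> C * (C - 2 * a)"
        using False a by (intro mult_mono) auto
      moreover have "0 \<le> a\<^sup>2 / 4" by simp
      moreover have "(C - a / 2)\<^sup>2 = C * C - a * C + a\<^sup>2 / 4"
        by (simp add: power2_eq_square field_simps)
      moreover have "C * (C - 2 * a) = C * C - 2 * (a * C)" "r * (r - 2 * a) = r\<^sup>2 - 2 * (a * r)"
        by (simp_all add: power2_eq_square algebra_simps)
      ultimately show ?thesis using aC by linarith
    qed
    finally have "norm (y i + v - x i) \<le> C - a / 2"
      by (rule power2_le_imp_le) (use RC R in auto)
    moreover have "norm (y (Suc i) - x (Suc i)) \<le> norm (y i + v - x i) + norm (x (Suc i) - x i)"
      using norm_triangle_ineq4[of "y i + v - x i" "x (Suc i) - x i"]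
      by (simp add: y v_def algebra_simps)
    ultimately show ?case using slow[of i] by linarith
  qed
  have "(\<Sum>l<i. f (x l - y l)) = y i" for i
    by (induction i) (simp_all add: y)
  then show ?thesis
    using close f(1) unfolding C_def by (intro exI[of _ "\<lambda>i. f (x i - y i)"]) simp
qed

lemma sum_lessThan_add:
  fixes f :: "nat \<Rightarrow> 'a::comm_monoid_add"
  shows "sum f {..<m + n} = sum f {..<m} + (\<Sum>k<n. f (m + k))"
  by (induction n) (simp_all add: add.assoc)

text \<open>
  A block of \<open>N\<close> steps realises the move \<open>v\<close>: its displacement is \<open>v\<close> up to an error \<open>\<delta>\<close>, and it
  stays in a ball of radius \<open>R\<close> meanwhile, all in the natural unit \<open>\<surd>N\<close>.
\<close>
definition near_step :: "nat \<Rightarrow> real \<Rightarrow> real \<Rightarrow> 'a \<Rightarrow> (nat \<Rightarrow> 'a::real_normed_vector) \<Rightarrow> bool" where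
  "near_step N R \<delta> v f \<longleftrightarrow>
     norm ((\<Sum>k<N. f k) - sqrt N *\<^sub>R v) \<le> \<delta> * sqrt N \<and> (\<forall>n\<le>N. norm (\<Sum>k<n. f k) \<le> R * sqrt N)"

text \<open>
  Three errors add up: the errors of the moves realised so far, the distance of the planned path from
  the target, and the excursion within the current block.
\<close>
lemma near_steps_follow_path:
  fixes f v x :: "nat \<Rightarrow> 'a::real_normed_vector" and m n N :: nat
    and C R \<delta> :: real
  assumes near: "\<And>i. i < m \<Longrightarrow> near_step N R \<delta> (v i) (\<lambda>k. f (i * N + k))"
    and path: "\<And>i. norm ((\<Sum>l<i. v l) - x i) \<le> C"
    and N: "0 < N" and \<delta>: "0 \<le> \<delta>" and R: "0 \<le> R" and n: "n \<le> m * N"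
  shows "norm ((\<Sum>k<n. f k) - sqrt N *\<^sub>R x (n div N)) \<le> (C + m * \<delta> + R) * sqrt N"
proof -
  have ends: "norm ((\<Sum>k<i * N. f k) - sqrt N *\<^sub>R (\<Sum>l<i. v l)) \<le> i * \<delta> * sqrt N" if "i \<le> m" for i
    using that
  proof (induction i)
    case (Suc i)
    have split: "(\<Sum>k<Suc i * N. f k) = (\<Sum>k<i * N. f k) + (\<Sum>k<N. f (i * N + k))"
      using sum_lessThan_add[of f "i * N" N] by (simp add: add.commute)
    have "norm ((\<Sum>k<Suc i * N. f k) - sqrt N *\<^sub>R (\<Sum>l<Suc i. v l))
        = norm (((\<Sum>k<i * N. f k) - sqrt N *\<^sub>R (\<Sum>l<i. v l)) + ((\<Sum>k<N. f (i * N + k)) - sqrt N *\<^sub>R v i))"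
      by (simp only: split) (simp add: algebra_simps)
    also have "\<dots> \<le> i * \<delta> * sqrt N + \<delta> * sqrt N"
      using Suc near[of i] by (intro norm_triangle_mono) (auto simp: near_step_def)
    finally show ?case by (simp add: algebra_simps)
  qed simp
  define i j where "i = n div N" and "j = n mod N"
  have nij: "n = i * N + j" "j < N"
    using div_mult_mod_eq[of n N] mod_less_divisor[OF N] by (simp_all only: i_def j_def)
  have im: "i \<le> m"
    using div_le_mono[OF n, of N] N by (simp add: i_def)
  have last: "norm (\<Sum>k<j. f (i * N + k)) \<le> R * sqrt N"
  proof (cases "i < m")
    case True
    then have "near_step N R \<delta> (v i) (\<lambda>k. f (i * N + k))" by (rule near)
    then show ?thesis using nij(2) unfolding near_step_def by (meson less_imp_le)
  next
    case False
    then have "i = m" using im by simp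
    then have "j = 0" using n nij(1) by simp
    then show ?thesis using R by simp
  qed
  have "norm (sqrt N *\<^sub>R ((\<Sum>l<i. v l) - x i)) \<le> C * sqrt N"
    using mult_right_mono[OF path[of i], of "sqrt N"] by (simp add: mult.commute)
  moreover have "norm ((\<Sum>k<i * N. f k) - sqrt N *\<^sub>R (\<Sum>l<i. v l)) \<le> m * \<delta> * sqrt N"
    using ends[OF im] im \<delta> by (elim order_trans) (intro mult_right_mono, auto)
  moreover have "(\<Sum>k<n. f k) - sqrt N *\<^sub>R x i = ((\<Sum>k<i * N. f k) - sqrt N *\<^sub>R (\<Sum>l<i. v l))
      + sqrt N *\<^sub>R ((\<Sum>l<i. v l) - x i) + (\<Sum>k<j. f (i * N + k))"
    by (subst nij(1)) (simp add: sum_lessThan_add scaleR_diff_right)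
  ultimately have "norm ((\<Sum>k<n. f k) - sqrt N *\<^sub>R x i) \<le> m * \<delta> * sqrt N + C * sqrt N + R * sqrt N"
    using last by (simp only:) (intro norm_triangle_mono)
  then show ?thesis by (simp add: i_def algebra_simps)
qed

text \<open>
  Here \<open>p\<close> steps have been made before the itinerary begins, and they have stayed close to the
  origin, hence close to the starting point of the curve. Half of the admissible error \<open>\<rho> s\<close> is
  spent on the past and on the deviation from the target, and a quarter on the mesh of the
  discretised curve.
\<close>
lemma tracks_if_near_steps:
  fixes f v :: "nat \<Rightarrow> 'a::real_normed_vector" and \<gamma> :: "real \<Rightarrow> 'a" and m N p :: nat
    and C R \<delta> \<rho> \<Lambda> \<kappa> :: real
  assumes lip: "\<And>t u. t \<in> {0..1} \<Longrightarrow> u \<in> {0..1} \<Longrightarrow> norm (\<gamma> t - \<gamma> u) \<le> \<Lambda> * \<bar>t - u\<bar>"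
    and \<gamma>0: "\<gamma> 0 = 0"
    and near: "\<And>i. i < m \<Longrightarrow> near_step N R \<delta> (v i) (\<lambda>k. f (p + (i * N + k)))"
    and path: "\<And>i. norm ((\<Sum>l<i. v l) - \<kappa> *\<^sub>R \<gamma> (min 1 (i / m))) \<le> C"
    and start: "\<And>n. n \<le> p \<Longrightarrow> norm (\<Sum>k<n. f k) \<le> \<rho> * \<kappa> / 4 * sqrt N"
    and pos: "0 < N" "0 < m" "0 < \<kappa>" "0 \<le> \<delta>" "0 \<le> R" "0 \<le> \<Lambda>" "0 \<le> \<rho>"
    and error: "C + m * \<delta> + R \<le> \<rho> * \<kappa> / 4" and mesh: "\<Lambda> \<le> \<rho> * m / 4"
  shows "tracks \<rho> (\<kappa> * sqrt N) \<gamma> ((\<lambda>n. \<Sum>k<n. f k) ` {0..p + m * N})"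
proof -
  define s where "s = \<kappa> * sqrt N"
  have s: "s > 0" using pos by (simp add: s_def)
  have after: "norm ((\<Sum>k<p + n. f k) - s *\<^sub>R \<gamma> (min 1 (real (n div N) / m))) \<le> \<rho> / 2 * s"
    if n: "n \<le> m * N" for n
  proof -
    have "norm ((\<Sum>k<n. f (p + k)) - sqrt N *\<^sub>R \<kappa> *\<^sub>R \<gamma> (min 1 (real (n div N) / m)))
        \<le> (C + m * \<delta> + R) * sqrt N"
      using near_steps_follow_path[where f = "\<lambda>k. f (p + k)" and v = v
          and x = "\<lambda>i. \<kappa> *\<^sub>R \<gamma> (min 1 (i / m))", OF near path pos(1,4,5) n] .
    also have "\<dots> \<le> \<rho> * \<kappa> / 4 * sqrt N"
      using error by (intro mult_right_mono) auto
    finally have "norm ((\<Sum>k<n. f (p + k)) - s *\<^sub>R \<gamma> (min 1 (real (n div N) / m))) \<le> \<rho> * \<kappa> / 4 * sqrt N"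
      by (simp add: s_def mult.commute)
    moreover have "norm (\<Sum>k<p. f k) \<le> \<rho> * \<kappa> / 4 * sqrt N" using start by simp
    ultimately have "norm ((\<Sum>k<p. f k) + ((\<Sum>k<n. f (p + k)) - s *\<^sub>R \<gamma> (min 1 (real (n div N) / m))))
        \<le> \<rho> * \<kappa> / 4 * sqrt N + \<rho> * \<kappa> / 4 * sqrt N"
      by (intro norm_triangle_mono)
    moreover have "(\<Sum>k<p + n. f k) = (\<Sum>k<p. f k) + (\<Sum>k<n. f (p + k))" by (rule sum_lessThan_add)
    ultimately show ?thesis by (simp add: s_def add_diff_eq mult.left_commute)
  qed
  have "\<exists>t\<in>{0..1}. norm ((\<Sum>k<n. f k) - s *\<^sub>R \<gamma> t) \<le> \<rho> * s" if n: "n \<le> p + m * N" for n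
  proof (cases "n \<le> p")
    case True
    have "\<rho> * \<kappa> / 4 * sqrt N \<le> \<rho> * s" using pos by (simp add: s_def)
    then show ?thesis using start[OF True] by (intro bexI[of _ 0]) (auto simp: \<gamma>0)
  next
    case False
    have "\<rho> / 2 * s \<le> \<rho> * s" using s pos by (intro mult_right_mono) auto
    moreover have "n - p \<le> m * N" "p + (n - p) = n" using n False by auto
    ultimately show ?thesis using after[of "n - p"]
      by (intro bexI[of _ "min 1 (real ((n - p) div N) / m)"]) auto
  qed
  moreover have "\<exists>n\<le>p + m * N. norm ((\<Sum>k<n. f k) - s *\<^sub>R \<gamma> t) \<le> \<rho> * s" if t: "t \<in> {0..1}" for t
  proof -
    define i where "i = nat \<lfloor>t * m\<rfloor>"
    have "0 \<le> t * m" using t by simp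
    then have i: "real i \<le> t * m" "t * m < real i + 1" unfolding i_def by linarith+
    have "t * real m \<le> 1 * real m" using t by (intro mult_right_mono) auto
    then have im: "i \<le> m" using i(1) by linarith
    define u where "u = min 1 (real i / m)"
    have u: "u = real i / m" "u \<in> {0..1}" using im pos by (auto simp: u_def)
    have "u - t = (real i - t * m) / m" using pos(2) by (simp add: u diff_divide_distrib)
    then have "\<bar>u - t\<bar> \<le> 1 / m" using i pos(2) by (simp add: divide_right_mono)
    then have "norm (\<gamma> u - \<gamma> t) \<le> \<Lambda> * (1 / m)"
      using lip[OF u(2) t] pos by (meson mult_left_mono order_trans)
    also have "\<dots> \<le> \<rho> / 4" using mesh pos(2) by (simp add: field_simps)
    finally have "norm (s *\<^sub>R \<gamma> u - s *\<^sub>R \<gamma> t) \<le> \<rho> / 4 * s"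
      using s by (simp flip: scaleR_diff_right)
    moreover have "norm ((\<Sum>k<p + i * N. f k) - s *\<^sub>R \<gamma> u) \<le> \<rho> / 2 * s"
      using after[of "i * N"] im pos(1) by (simp add: u_def)
    ultimately have "norm (((\<Sum>k<p + i * N. f k) - s *\<^sub>R \<gamma> u) + (s *\<^sub>R \<gamma> u - s *\<^sub>R \<gamma> t)) \<le> \<rho> / 2 * s + \<rho> / 4 * s"
      by (intro norm_triangle_mono)
    also have "\<dots> \<le> \<rho> * s" using s pos by (simp add: field_simps)
    finally show ?thesis using im by (intro exI[of _ "p + i * N"]) simp
  qed
  ultimately show ?thesis unfolding tracks_def s_def by force
qed

section \<open>Moments of the partial sums\<close>

lemma std_normal_cdf_less_1: "cdf std_normal_distribution x < 1"
proof -
  interpret real_distribution std_normal_distribution by (rule real_dist_normal_dist)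
  have "measure std_normal_distribution {x<..} \<noteq> 0"
  proof
    assume "measure std_normal_distribution {x<..} = 0"
    then have "{x<..} \<in> null_sets std_normal_distribution"
      by (simp add: null_sets_def emeasure_eq_measure)
    then have "AE y in lborel. y \<in> {x<..} \<longrightarrow> ennreal (std_normal_density y) = 0"
      by (subst (asm) null_sets_density_iff) auto
    then have "AE y in lborel. y \<notin> {x<..}"
    proof (rule AE_mp, intro AE_I2 impI)
      fix y assume *: "y \<in> {x<..} \<longrightarrow> ennreal (std_normal_density y) = 0"
      have "std_normal_density y > 0" by (simp add: normal_density_pos)
      then show "y \<notin> {x<..}" using * by (auto simp: ennreal_eq_0_iff)
    qed
    moreover have "{y \<in> space lborel. \<not> y \<notin> {x<..}} = {x<..}" by auto
    ultimately have "emeasure lborel {x<..} = 0"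
      using AE_iff_null[of lborel "\<lambda>y. y \<notin> {x<..}"] by (simp add: null_sets_def)
    moreover have "emeasure lborel {x<..<x+1} \<le> emeasure lborel {x<..}"
      by (intro emeasure_mono) auto
    ultimately show False by simp
  qed
  then have "measure std_normal_distribution {x<..} > 0" by (simp add: zero_less_measure_iff)
  moreover have "measure std_normal_distribution {x<..} = 1 - cdf std_normal_distribution x"
    using prob_compl[of "{..x}"] by (simp add: cdf_def2 Compl_eq_Diff_UNIV[symmetric])
  ultimately show ?thesis by simp
qed

lemma isCont_std_normal_cdf: "isCont (cdf std_normal_distribution) x"
proof -
  interpret real_distribution std_normal_distribution by (rule real_dist_normal_dist)
  have ae: "AE y in lborel. y \<in> {x} \<longrightarrow> ennreal (std_normal_density y) = 0"
    by (rule AE_mp[OF AE_lborel_singleton[of x]]) (rule AE_I2, simp)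
  have "{x} \<in> null_sets std_normal_distribution"
    by (rule null_sets_density_iff[THEN iffD2]) (simp, intro conjI ae, simp)
  then have "measure std_normal_distribution {x} = 0" by (simp add: null_sets_def measure_def)
  then show ?thesis by (simp add: isCont_cdf)
qed

text \<open>
  The dimension is arbitrary here: only the shapes to be drawn are planar. Nondegeneracy is what the
  central limit theorem requires of every projection to a line.
\<close>
locale centered_iid_steps = prob_space M for M :: "'w measure" +
  fixes Y :: "nat \<Rightarrow> 'w \<Rightarrow> 'a::euclidean_space"
  assumes indep: "indep_vars (\<lambda>_. borel) Y UNIV"
    and ident: "\<And>k. distr M borel (Y k) = distr M borel (Y 0)"
    and square_integrable: "integrable M (\<lambda>\<omega>. (norm (Y 0 \<omega>))\<^sup>2)"
    and mean_zero: "(\<integral>\<omega>. Y 0 \<omega> \<partial>M) = 0"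
    and nondegenerate: "\<And>u. u \<noteq> 0 \<Longrightarrow> 0 < (\<integral>\<omega>. (u \<bullet> Y 0 \<omega>)\<^sup>2 \<partial>M)"
begin

definition S :: "nat \<Rightarrow> 'w \<Rightarrow> 'a" where
  "S n \<omega> = (\<Sum>k<n. Y k \<omega>)"

definition total_variance :: real where
  "total_variance = (\<integral>\<omega>. (norm (Y 0 \<omega>))\<^sup>2 \<partial>M)"

lemma measurable_Y [measurable]: "Y k \<in> borel_measurable M"
  using indep by (simp add: indep_vars_def)

lemma measurable_S [measurable]: "S k \<in> borel_measurable M"
  unfolding S_def by measurable

lemma integrable_step_iff:
  fixes g :: "'a \<Rightarrow> 'b::{banach, second_countable_topology}"
  assumes [measurable]: "g \<in> borel_measurable borel"
  shows "integrable M (\<lambda>\<omega>. g (Y k \<omega>)) \<longleftrightarrow> integrable M (\<lambda>\<omega>. g (Y 0 \<omega>))"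
proof -
  have "integrable M (\<lambda>\<omega>. g (Y k \<omega>)) \<longleftrightarrow> integrable (distr M borel (Y k)) g" for k
    by (rule integrable_distr_eq[symmetric]) auto
  then show ?thesis using ident[of k] by simp
qed

lemma integral_step:
  fixes g :: "'a \<Rightarrow> 'b::{banach, second_countable_topology}"
  assumes [measurable]: "g \<in> borel_measurable borel"
  shows "(\<integral>\<omega>. g (Y k \<omega>) \<partial>M) = (\<integral>\<omega>. g (Y 0 \<omega>) \<partial>M)"
proof -
  have "(\<integral>\<omega>. g (Y k \<omega>) \<partial>M) = (\<integral>x. g x \<partial>distr M borel (Y k))" for k
    by (rule integral_distr[symmetric]) auto
  then show ?thesis using ident[of k] by simp
qed

lemma integrable_norm_square: "integrable M (\<lambda>\<omega>. (norm (Y k \<omega>))\<^sup>2)"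
  using integrable_step_iff[of "\<lambda>x. (norm x)\<^sup>2"] square_integrable by simp

lemma integrable_Y: "integrable M (Y k)"
proof (rule Bochner_Integration.integrable_bound)
  show "integrable M (\<lambda>\<omega>. 1 + (norm (Y k \<omega>))\<^sup>2)"
    using integrable_norm_square by simp
  show "AE \<omega> in M. norm (Y k \<omega>) \<le> norm (1 + (norm (Y k \<omega>))\<^sup>2)"
  proof (rule AE_I2)
    fix \<omega>
    have "0 \<le> (norm (Y k \<omega>) - 1)\<^sup>2" by simp
    then have "2 * norm (Y k \<omega>) \<le> 1 + (norm (Y k \<omega>))\<^sup>2"
      by (simp add: power2_eq_square algebra_simps)
    moreover have "norm (Y k \<omega>) \<ge> 0" by simp
    ultimately show "norm (Y k \<omega>) \<le> norm (1 + (norm (Y k \<omega>))\<^sup>2)"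
      unfolding real_norm_def by linarith
  qed
qed simp

lemma expectation_Y: "(\<integral>\<omega>. Y k \<omega> \<partial>M) = 0"
  using integral_step[of "\<lambda>x. x" k] mean_zero by simp

lemma inner_square_le: "(u \<bullet> x)\<^sup>2 \<le> (norm u)\<^sup>2 * (norm x)\<^sup>2" for u x :: 'a
  using power_mono[OF Cauchy_Schwarz_ineq2[of u x], of 2] by (simp add: power_mult_distrib)

lemma integrable_inner_square: "integrable M (\<lambda>\<omega>. (u \<bullet> Y k \<omega>)\<^sup>2)"
  by (rule Bochner_Integration.integrable_bound[where f = "\<lambda>\<omega>. (norm u)\<^sup>2 * (norm (Y k \<omega>))\<^sup>2"])
    (auto simp: integrable_norm_square inner_square_le)

lemma indep_inner: "indep_vars (\<lambda>_. borel) (\<lambda>k \<omega>. u \<bullet> Y k \<omega>) UNIV"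
  using indep_vars_compose2[OF indep, of "\<lambda>_ x. u \<bullet> x" "\<lambda>_. borel"] by simp

lemma uncorrelated:
  assumes "i \<noteq> j"
  shows "integrable M (\<lambda>\<omega>. (u \<bullet> Y i \<omega>) * (u \<bullet> Y j \<omega>))"
    and "(\<integral>\<omega>. (u \<bullet> Y i \<omega>) * (u \<bullet> Y j \<omega>) \<partial>M) = 0"
proof -
  have ind: "indep_vars (\<lambda>_. borel) (\<lambda>k \<omega>. u \<bullet> Y k \<omega>) {i, j}"
    using indep_inner indep_vars_subset by blast
  have int: "integrable M (\<lambda>\<omega>. u \<bullet> Y k \<omega>)" for k
    using integrable_Y by simp
  show "integrable M (\<lambda>\<omega>. (u \<bullet> Y i \<omega>) * (u \<bullet> Y j \<omega>))"
    using indep_vars_integrable[OF _ ind] int assms by simp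
  have "(\<integral>\<omega>. u \<bullet> Y i \<omega> \<partial>M) = 0"
    using integral_inner_right[of u M "Y i"] integrable_Y expectation_Y by simp
  then show "(\<integral>\<omega>. (u \<bullet> Y i \<omega>) * (u \<bullet> Y j \<omega>) \<partial>M) = 0"
    using indep_vars_lebesgue_integral[OF _ ind] int assms by simp
qed

lemma
  assumes J: "finite J"
  shows integrable_inner_sum_square: "integrable M (\<lambda>\<omega>. (u \<bullet> (\<Sum>k\<in>J. Y k \<omega>))\<^sup>2)"
    and expectation_inner_sum_square:
      "(\<integral>\<omega>. (u \<bullet> (\<Sum>k\<in>J. Y k \<omega>))\<^sup>2 \<partial>M) = card J * (\<integral>\<omega>. (u \<bullet> Y 0 \<omega>)\<^sup>2 \<partial>M)"
proof -
  have expand: "(u \<bullet> (\<Sum>k\<in>J. Y k \<omega>))\<^sup>2 = (\<Sum>i\<in>J. \<Sum>j\<in>J. (u \<bullet> Y i \<omega>) * (u \<bullet> Y j \<omega>))" for \<omega>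
    by (simp add: inner_sum_right power2_eq_square sum_product)
  have int: "integrable M (\<lambda>\<omega>. (u \<bullet> Y i \<omega>) * (u \<bullet> Y j \<omega>))" for i j
    using uncorrelated(1)[of i j u] integrable_inner_square[of u i]
    by (cases "i = j") (simp_all add: power2_eq_square)
  have cov: "(\<integral>\<omega>. (u \<bullet> Y i \<omega>) * (u \<bullet> Y j \<omega>) \<partial>M) = (if i = j then \<integral>\<omega>. (u \<bullet> Y 0 \<omega>)\<^sup>2 \<partial>M else 0)"
    for i j
    using uncorrelated(2)[of i j u] integral_step[of "\<lambda>x. (u \<bullet> x)\<^sup>2" i]
    by (cases "i = j") (simp_all add: power2_eq_square)
  show "integrable M (\<lambda>\<omega>. (u \<bullet> (\<Sum>k\<in>J. Y k \<omega>))\<^sup>2)"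
    unfolding expand by (intro Bochner_Integration.integrable_sum int)
  show "(\<integral>\<omega>. (u \<bullet> (\<Sum>k\<in>J. Y k \<omega>))\<^sup>2 \<partial>M) = card J * (\<integral>\<omega>. (u \<bullet> Y 0 \<omega>)\<^sup>2 \<partial>M)"
    unfolding expand using J
    by (simp add: Bochner_Integration.integral_sum Bochner_Integration.integrable_sum int cov)
qed

lemma norm_square_eq_sum: "(norm x)\<^sup>2 = (\<Sum>b\<in>Basis. (b \<bullet> x)\<^sup>2)" for x :: 'a
  unfolding power2_norm_eq_inner by (subst euclidean_inner) (simp add: power2_eq_square inner_commute)

lemma
  assumes J: "finite J"
  shows integrable_norm_sum_square: "integrable M (\<lambda>\<omega>. (norm (\<Sum>k\<in>J. Y k \<omega>))\<^sup>2)"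
    and expectation_norm_sum_square: "(\<integral>\<omega>. (norm (\<Sum>k\<in>J. Y k \<omega>))\<^sup>2 \<partial>M) = card J * total_variance"
  unfolding total_variance_def norm_square_eq_sum using J integrable_inner_square
  by (simp_all add: integrable_inner_sum_square expectation_inner_sum_square
      Bochner_Integration.integral_sum sum_distrib_left)

text \<open>
  Chebyshev's inequality; the steps are uncorrelated, so the second moment is additive.
\<close>
lemma prob_norm_sum_ge:
  assumes J: "finite J" and r: "0 < r"
  shows "prob {\<omega> \<in> space M. r \<le> norm (\<Sum>k\<in>J. Y k \<omega>)} \<le> card J * total_variance / r\<^sup>2"
proof -
  have "prob {\<omega> \<in> space M. r \<le> norm (\<Sum>k\<in>J. Y k \<omega>)}
      = prob {\<omega> \<in> space M. r\<^sup>2 \<le> (norm (\<Sum>k\<in>J. Y k \<omega>))\<^sup>2}"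
    using r by (intro arg_cong[where f = prob] Collect_cong conj_cong refl)
      (simp add: abs_le_square_iff[symmetric])
  also have "\<dots> \<le> (\<integral>\<omega>. (norm (\<Sum>k\<in>J. Y k \<omega>))\<^sup>2 \<partial>M) / r\<^sup>2"
    using integrable_norm_sum_square[OF J] r
    by (intro integral_Markov_inequality_measure[where A = "{}"]) auto
  finally show ?thesis by (simp add: expectation_norm_sum_square[OF J])
qed

lemma total_variance_pos: "0 < total_variance"
proof -
  obtain b :: 'a where b: "b \<in> Basis" using nonempty_Basis by blast
  then have "0 < (\<integral>\<omega>. (b \<bullet> Y 0 \<omega>)\<^sup>2 \<partial>M)" by (intro nondegenerate) auto
  also have "\<dots> \<le> total_variance"
    unfolding total_variance_def using inner_square_le[of b] b
    by (intro integral_mono integrable_inner_square integrable_norm_square) simp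
  finally show ?thesis .
qed

end

section \<open>Independence of blocks and the maximal inequality\<close>

text \<open>
  A measurable property of the first \<open>N\<close> terms of a sequence. Evaluated at the sequence of steps
  from time \<open>p\<close> on, it becomes an event that depends on the block \<open>{p..<p + N}\<close> only, with a
  probability that does not depend on \<open>p\<close>.
\<close>
definition block_predicate :: "nat \<Rightarrow> ((nat \<Rightarrow> 'a::topological_space) \<Rightarrow> bool) \<Rightarrow> bool" where
  "block_predicate N Q \<longleftrightarrow>
     (\<forall>f. Q (restrict f {..<N}) = Q f) \<and>
     {f \<in> space (PiM {..<N} (\<lambda>_. borel)). Q f} \<in> sets (PiM {..<N} (\<lambda>_. borel))"

context centered_iid_steps
begin

lemma indep_blocks:
  assumes disj: "disjoint_family_on (\<lambda>i. {p i..<p i + n i}) I"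
  shows "indep_vars (\<lambda>i. PiM {..<n i} (\<lambda>_. borel)) (\<lambda>i \<omega>. \<lambda>k\<in>{..<n i}. Y (p i + k) \<omega>) I"
proof -
  have "indep_vars (\<lambda>i. PiM {p i..<p i + n i} (\<lambda>_. borel))
      (\<lambda>i \<omega>. restrict (\<lambda>k. Y k \<omega>) {p i..<p i + n i}) I"
    by (rule indep_vars_restrict[OF indep _ disj]) simp
  then have "indep_vars (\<lambda>i. PiM {..<n i} (\<lambda>_. borel))
      (\<lambda>i \<omega>. (\<lambda>g. \<lambda>k\<in>{..<n i}. g (p i + k)) (restrict (\<lambda>k. Y k \<omega>) {p i..<p i + n i})) I"
  proof (rule indep_vars_compose2)
    fix i
    show "(\<lambda>g. \<lambda>k\<in>{..<n i}. g (p i + k)) \<in>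
        PiM {p i..<p i + n i} (\<lambda>_. borel) \<rightarrow>\<^sub>M PiM {..<n i} (\<lambda>_. borel)"
      by (intro measurable_restrict measurable_component_singleton) auto
  qed
  moreover have "(\<lambda>k\<in>{..<n i}. restrict (\<lambda>k. Y k \<omega>) {p i..<p i + n i} (p i + k)) =
      (\<lambda>k\<in>{..<n i}. Y (p i + k) \<omega>)" for i \<omega>
    by (rule restrict_ext) simp
  ultimately show ?thesis by simp
qed

lemma indep_events_blocks:
  assumes "disjoint_family_on (\<lambda>i. {p i..<p i + n i}) I"
    and Q: "\<And>i. i \<in> I \<Longrightarrow> block_predicate (n i) (Q i)"
  shows "indep_events (\<lambda>i. {\<omega> \<in> space M. Q i (\<lambda>k. Y (p i + k) \<omega>)}) I"
proof -
  have "indep_events (\<lambda>i. {\<omega> \<in> space M. Q i (\<lambda>k\<in>{..<n i}. Y (p i + k) \<omega>)}) I"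
    using Q by (intro indep_eventsI_indep_vars[OF indep_blocks[OF assms(1)]])
      (auto simp: block_predicate_def)
  then show ?thesis
    unfolding indep_events_def_alt
    by (rule indep_sets_cong[THEN iffD1, rotated 2]) (use Q in \<open>auto simp: block_predicate_def\<close>)
qed

lemma block_distribution:
  "distr M (PiM {..<n} (\<lambda>_. borel)) (\<lambda>\<omega>. \<lambda>k\<in>{..<n}. Y (p + k) \<omega>)
    = PiM {..<n} (\<lambda>_. distr M borel (Y 0))"
proof (cases "n = 0")
  case True
  have "distr M (PiM {} (\<lambda>_. borel)) (\<lambda>\<omega>. \<lambda>k\<in>{}. Y (p + k) \<omega>) = PiM {} (\<lambda>_. borel)"
    by (rule measure_eqI)
      (auto simp: emeasure_distr sets_PiM_empty space_PiM_empty emeasure_space_1 restrict_def)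
  also have "\<dots> = PiM {} (\<lambda>_. distr M borel (Y 0))"
    by (rule measure_eqI) (auto simp: sets_PiM_empty)
  finally show ?thesis using True by simp
next
  case False
  have "indep_vars (\<lambda>_. borel) (\<lambda>k. Y (p + k)) {..<n}"
  proof -
    have "indep_vars (\<lambda>k. PiM {..<1} (\<lambda>_. borel)) (\<lambda>k \<omega>. \<lambda>j\<in>{..<1}. Y (p + k + j) \<omega>) {..<n}"
      by (rule indep_blocks) (auto simp: disjoint_family_on_def)
    moreover have "(\<lambda>g. g 0) \<in> PiM {..<1::nat} (\<lambda>_. borel :: 'a measure) \<rightarrow>\<^sub>M borel"
      by (intro measurable_component_singleton) auto
    ultimately have "indep_vars (\<lambda>_. borel) (\<lambda>k \<omega>. (\<lambda>j\<in>{..<1}. Y (p + k + j) \<omega>) (0::nat)) {..<n}"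
      by (rule indep_vars_compose2)
    then show ?thesis by simp
  qed
  then have "distr M (PiM {..<n} (\<lambda>_. borel)) (\<lambda>\<omega>. \<lambda>k\<in>{..<n}. Y (p + k) \<omega>)
      = PiM {..<n} (\<lambda>k. distr M borel (Y (p + k)))"
    using False by (subst (asm) indep_vars_iff_distr_eq_PiM') auto
  also have "(\<lambda>k. distr M borel (Y (p + k))) = (\<lambda>_. distr M borel (Y 0))"
    by (rule ext) (rule ident)
  finally show ?thesis .
qed

lemma prob_block:
  assumes Q: "block_predicate n Q"
  shows "prob {\<omega> \<in> space M. Q (\<lambda>k. Y (p + k) \<omega>)} = prob {\<omega> \<in> space M. Q (\<lambda>k. Y k \<omega>)}"
proof -
  let ?P = "PiM {..<n} (\<lambda>_. borel) :: (nat \<Rightarrow> 'a) measure"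
  have "prob {\<omega> \<in> space M. Q (\<lambda>k. Y (p + k) \<omega>)}
      = measure (PiM {..<n} (\<lambda>_. distr M borel (Y 0))) {f \<in> space ?P. Q f}" for p
  proof -
    have rv: "(\<lambda>\<omega>. \<lambda>k\<in>{..<n}. Y (p + k) \<omega>) \<in> M \<rightarrow>\<^sub>M ?P"
      by (intro measurable_restrict measurable_Y)
    have "prob {\<omega> \<in> space M. Q (\<lambda>k. Y (p + k) \<omega>)}
        = prob ((\<lambda>\<omega>. \<lambda>k\<in>{..<n}. Y (p + k) \<omega>) -` {f \<in> space ?P. Q f} \<inter> space M)"
      using Q measurable_space[OF rv]
      by (intro arg_cong[where f = prob]) (auto simp: block_predicate_def)
    also have "\<dots> = measure (distr M ?P (\<lambda>\<omega>. \<lambda>k\<in>{..<n}. Y (p + k) \<omega>)) {f \<in> space ?P. Q f}"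
      using Q rv by (intro measure_distr[symmetric]) (auto simp: block_predicate_def)
    finally show ?thesis by (simp only: block_distribution)
  qed
  from this[of p] this[of 0] show ?thesis by simp
qed

lemma prob_two_blocks:
  assumes "block_predicate p Q1" "block_predicate n Q2"
  shows "prob {\<omega> \<in> space M. Q1 (\<lambda>k. Y k \<omega>) \<and> Q2 (\<lambda>k. Y (p + k) \<omega>)}
    = prob {\<omega> \<in> space M. Q1 (\<lambda>k. Y k \<omega>)} * prob {\<omega> \<in> space M. Q2 (\<lambda>k. Y (p + k) \<omega>)}"
proof -
  define F where "F b = {\<omega> \<in> space M. (if b then Q2 else Q1) (\<lambda>k. Y ((if b then p else 0) + k) \<omega>)}" for b
  have "indep_events F UNIV"
    unfolding F_def
    by (rule indep_events_blocks[where n = "\<lambda>b. if b then n else p"])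
      (use assms in \<open>auto simp: disjoint_family_on_def\<close>)
  then have "prob (\<Inter>b\<in>UNIV. F b) = (\<Prod>b\<in>UNIV. prob (F b))"
    unfolding indep_events_def by (metis finite_class.finite_UNIV subset_UNIV UNIV_not_empty)
  moreover have "(\<Inter>b\<in>UNIV. F b) = {\<omega> \<in> space M. Q1 (\<lambda>k. Y k \<omega>) \<and> Q2 (\<lambda>k. Y (p + k) \<omega>)}"
    by (auto simp: F_def UNIV_bool)
  ultimately show ?thesis by (simp add: F_def UNIV_bool mult.commute)
qed

lemma block_predicateI:
  assumes "\<And>f. Q (restrict f {..<n}) = Q f"
    and "Measurable.pred (PiM {..<n} (\<lambda>_. borel)) Q"
  shows "block_predicate n Q"
  using assms by (simp add: block_predicate_def pred_def)

lemma measurable_partial_sum: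
  fixes n N :: nat
  assumes "n \<le> N"
  shows "(\<lambda>f. \<Sum>k<n. f k) \<in> PiM {..<N} (\<lambda>_. borel :: 'a measure) \<rightarrow>\<^sub>M borel"
  using assms by (intro borel_measurable_sum measurable_component_singleton) auto

lemma partial_sum_restrict:
  fixes n N :: nat
  assumes "n \<le> N"
  shows "(\<Sum>k<n. restrict f {..<N} k) = (\<Sum>k<n. f k)"
  using assms by (intro sum.cong) auto

text \<open>
  Ottaviani's argument: at the first time \<open>n\<close> at which the walk leaves the ball of radius \<open>2 r\<close>, the
  remaining increment is independent of the past and shorter than \<open>r\<close> with probability at least
  \<open>1/2\<close>, in which case the walk ends outside the ball of radius \<open>r\<close>.
\<close>
lemma maximal_inequality:
  fixes N :: nat
  assumes r: "0 < r" "2 * N * total_variance \<le> r\<^sup>2"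
  shows "prob {\<omega> \<in> space M. \<exists>n\<le>N. 2 * r < norm (S n \<omega>)} \<le> 2 * N * total_variance / r\<^sup>2"
proof -
  \<comment> \<open>\<open>n\<close> is the first exit time; from then on the walk moves by less than \<open>r\<close>.\<close>
  define A where "A n \<omega> \<longleftrightarrow> 2 * r < norm (S n \<omega>) \<and> (\<forall>k<n. norm (S k \<omega>) \<le> 2 * r)" for n \<omega>
  define B where "B n \<omega> \<longleftrightarrow> norm (\<Sum>k<N - n. Y (n + k) \<omega>) < r" for n \<omega>
  have meas [measurable]: "Measurable.pred M (A n)" "Measurable.pred M (B n)" for n
    unfolding A_def B_def by measurable
  have half: "1 / 2 \<le> prob {\<omega> \<in> space M. B n \<omega>}" if "n \<le> N" for n
  proof -
    have shift: "(\<Sum>k<N - n. Y (n + k) \<omega>) = (\<Sum>k\<in>{n..<N}. Y k \<omega>)" for \<omega>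
      using that by (intro sum.reindex_bij_witness[of _ "\<lambda>k. k - n" "\<lambda>k. n + k"]) auto
    have "{\<omega> \<in> space M. B n \<omega>} = space M - {\<omega> \<in> space M. r \<le> norm (\<Sum>k\<in>{n..<N}. Y k \<omega>)}"
      unfolding B_def shift by auto
    then have "prob {\<omega> \<in> space M. B n \<omega>} = 1 - prob {\<omega> \<in> space M. r \<le> norm (\<Sum>k\<in>{n..<N}. Y k \<omega>)}"
      by (simp add: prob_compl)
    moreover have "prob {\<omega> \<in> space M. r \<le> norm (\<Sum>k\<in>{n..<N}. Y k \<omega>)} \<le> card {n..<N} * total_variance / r\<^sup>2"
      using r by (intro prob_norm_sum_ge) auto
    moreover have "card {n..<N} * total_variance / r\<^sup>2 \<le> N * total_variance / r\<^sup>2"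
      using total_variance_pos by (intro divide_right_mono mult_right_mono) auto
    moreover have "N * total_variance / r\<^sup>2 \<le> 1 / 2" using r by (simp add: field_simps)
    ultimately show ?thesis by linarith
  qed
  have indepAB: "prob {\<omega> \<in> space M. A n \<omega> \<and> B n \<omega>} = prob {\<omega> \<in> space M. A n \<omega>} * prob {\<omega> \<in> space M. B n \<omega>}" for n
    unfolding A_def B_def S_def
  proof (rule prob_two_blocks)
    show "block_predicate n (\<lambda>f. 2 * r < norm (\<Sum>k<n. f k) \<and> (\<forall>k<n. norm (\<Sum>k<k. f k :: 'a) \<le> 2 * r))"
    proof (rule block_predicateI)
      show "Measurable.pred (PiM {..<n} (\<lambda>_. borel))
          (\<lambda>f. 2 * r < norm (\<Sum>k<n. f k) \<and> (\<forall>k<n. norm (\<Sum>k<k. f k :: 'a) \<le> 2 * r))"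
        by (intro pred_intros_logic pred_intros_finite borel_measurable_pred_less borel_measurable_le
            borel_measurable_norm measurable_partial_sum borel_measurable_const) auto
    qed (auto simp: partial_sum_restrict)
    show "block_predicate (N - n) (\<lambda>f. norm (\<Sum>k<N - n. f k :: 'a) < r)"
      by (rule block_predicateI) (auto simp: partial_sum_restrict intro!: borel_measurable_pred_less
          borel_measurable_norm measurable_partial_sum)
  qed
  have "{\<omega> \<in> space M. \<exists>n\<le>N. 2 * r < norm (S n \<omega>)} = (\<Union>n\<in>{..N}. {\<omega> \<in> space M. A n \<omega>})"
  proof (intro equalityI subsetI)
    fix \<omega> assume \<omega>: "\<omega> \<in> {\<omega> \<in> space M. \<exists>n\<le>N. 2 * r < norm (S n \<omega>)}"
    define n where "n = (LEAST n. 2 * r < norm (S n \<omega>))"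
    obtain m where m: "m \<le> N" "2 * r < norm (S m \<omega>)" using \<omega> by auto
    have "2 * r < norm (S n \<omega>)" unfolding n_def using m(2) by (rule LeastI)
    moreover have "norm (S k \<omega>) \<le> 2 * r" if "k < n" for k
      using not_less_Least[OF that[unfolded n_def]] by (simp only: not_less)
    ultimately have "A n \<omega>" unfolding A_def by blast
    moreover have "n \<le> N"
      using Least_le[of "\<lambda>n. 2 * r < norm (S n \<omega>)", OF m(2)] m(1) unfolding n_def by linarith
    ultimately show "\<omega> \<in> (\<Union>n\<in>{..N}. {\<omega> \<in> space M. A n \<omega>})" using \<omega> by auto
  qed (auto simp: A_def)
  then have "prob {\<omega> \<in> space M. \<exists>n\<le>N. 2 * r < norm (S n \<omega>)} \<le> (\<Sum>n\<le>N. prob {\<omega> \<in> space M. A n \<omega>})"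
    by (simp add: finite_measure_subadditive_finite image_subset_iff)
  also have "\<dots> \<le> (\<Sum>n\<le>N. 2 * prob {\<omega> \<in> space M. A n \<omega> \<and> B n \<omega>})"
  proof (rule sum_mono)
    fix n assume "n \<in> {..N}"
    then have "prob {\<omega> \<in> space M. A n \<omega>} * (1 / 2) \<le> prob {\<omega> \<in> space M. A n \<omega>} * prob {\<omega> \<in> space M. B n \<omega>}"
      using half by (intro mult_left_mono) auto
    then show "prob {\<omega> \<in> space M. A n \<omega>} \<le> 2 * prob {\<omega> \<in> space M. A n \<omega> \<and> B n \<omega>}"
      by (simp add: indepAB)
  qed
  also have "\<dots> = 2 * (\<Sum>n\<le>N. prob {\<omega> \<in> space M. A n \<omega> \<and> B n \<omega>})" by (simp add: sum_distrib_left)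
  also have "(\<Sum>n\<le>N. prob {\<omega> \<in> space M. A n \<omega> \<and> B n \<omega>}) = prob (\<Union>n\<in>{..N}. {\<omega> \<in> space M. A n \<omega> \<and> B n \<omega>})"
  proof (rule finite_measure_finite_Union[symmetric])
    show "disjoint_family_on (\<lambda>n. {\<omega> \<in> space M. A n \<omega> \<and> B n \<omega>}) {..N}"
      unfolding disjoint_family_on_def A_def by (auto simp: not_le[symmetric]) (metis linorder_neqE_nat not_le)
  qed auto
  also have "\<dots> \<le> prob {\<omega> \<in> space M. r \<le> norm (\<Sum>k\<in>{..<N}. Y k \<omega>)}"
  proof (rule finite_measure_mono)
    show "(\<Union>n\<in>{..N}. {\<omega> \<in> space M. A n \<omega> \<and> B n \<omega>}) \<subseteq> {\<omega> \<in> space M. r \<le> norm (\<Sum>k\<in>{..<N}. Y k \<omega>)}"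
    proof safe
      fix n \<omega> assume n: "n \<le> N" and AB: "A n \<omega>" "B n \<omega>"
      have "(\<Sum>k<N. Y k \<omega>) = S n \<omega> + (\<Sum>k<N - n. Y (n + k) \<omega>)"
        using sum_lessThan_add[of "\<lambda>k. Y k \<omega>" n "N - n"] n by (simp add: S_def)
      then have "norm (S n \<omega>) \<le> norm (\<Sum>k<N. Y k \<omega>) + norm (\<Sum>k<N - n. Y (n + k) \<omega>)"
        by (metis add_diff_cancel_right' norm_triangle_ineq4)
      then show "r \<le> norm (\<Sum>k<N. Y k \<omega>)" using AB unfolding A_def B_def by linarith
    qed
  qed auto
  also have "\<dots> \<le> N * total_variance / r\<^sup>2"
    using prob_norm_sum_ge[of "{..<N}" r] r by simp
  finally show ?thesis by simp
qed

end

section \<open>Moves available to a block of steps\<close>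

context centered_iid_steps
begin

text \<open>
  By the central limit theorem the probability converges to that of a standard normal variable
  exceeding \<open>1 / \<sigma>\<close>, where \<open>\<sigma>\<^sup>2\<close> is the variance of the projected steps.
\<close>
lemma eventually_prob_step_in_direction:
  assumes u: "u \<noteq> 0"
  shows "\<exists>c>0. \<forall>\<^sub>F N in sequentially. c \<le> prob {\<omega> \<in> space M. sqrt N < u \<bullet> S N \<omega>}"
proof -
  define \<sigma> where "\<sigma> = sqrt (\<integral>\<omega>. (u \<bullet> Y 0 \<omega>)\<^sup>2 \<partial>M)"
  have \<sigma>: "0 < \<sigma>" "\<sigma>\<^sup>2 = (\<integral>\<omega>. (u \<bullet> Y 0 \<omega>)\<^sup>2 \<partial>M)"
    using nondegenerate[OF u] by (simp_all add: \<sigma>_def)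
  define D where "D N = distr M borel (\<lambda>\<omega>. (\<Sum>k<N. u \<bullet> Y k \<omega>) / sqrt (N * \<sigma>\<^sup>2))" for N :: nat
  have zero: "(\<integral>\<omega>. u \<bullet> Y k \<omega> \<partial>M) = 0" for k
    using integral_inner_right[of u M "Y k"] integrable_Y expectation_Y by simp
  have "weak_conv_m D std_normal_distribution"
    unfolding D_def
  proof (rule central_limit_theorem_zero_mean)
    show "variance (\<lambda>\<omega>. u \<bullet> Y k \<omega>) = \<sigma>\<^sup>2" for k
      using integral_step[of "\<lambda>x. (u \<bullet> x)\<^sup>2" k] by (simp add: zero \<sigma>)
    show "distr M borel (\<lambda>\<omega>. u \<bullet> Y k \<omega>) = distr (distr M borel (Y 0)) borel ((\<bullet>) u)" for k
      by (subst ident[of k, symmetric]) (simp add: distr_distr comp_def)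
  qed (use indep_inner zero \<sigma> integrable_inner_square in auto)
  then have "(\<lambda>N. cdf (D N) (1 / \<sigma>)) \<longlonglongrightarrow> cdf std_normal_distribution (1 / \<sigma>)"
    using isCont_std_normal_cdf by (auto simp: weak_conv_m_def weak_conv_def)
  then have lim: "(\<lambda>N. 1 - cdf (D N) (1 / \<sigma>)) \<longlonglongrightarrow> 1 - cdf std_normal_distribution (1 / \<sigma>)"
    by (intro tendsto_intros)
  define c where "c = (1 - cdf std_normal_distribution (1 / \<sigma>)) / 2"
  have c: "0 < c" "c < 1 - cdf std_normal_distribution (1 / \<sigma>)"
    using std_normal_cdf_less_1[of "1 / \<sigma>"] by (simp_all add: c_def)
  have "\<forall>\<^sub>F N in sequentially. c \<le> prob {\<omega> \<in> space M. sqrt N < u \<bullet> S N \<omega>}"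
    using order_tendstoD(1)[OF lim c(2)] eventually_gt_at_top[of 0]
  proof eventually_elim
    case (elim N)
    have "cdf (D N) (1 / \<sigma>) = prob {\<omega> \<in> space M. (\<Sum>k<N. u \<bullet> Y k \<omega>) / sqrt (N * \<sigma>\<^sup>2) \<le> 1 / \<sigma>}"
      unfolding cdf_def2 D_def
      by (subst measure_distr) (auto intro!: arg_cong[where f = prob])
    also have "\<dots> = 1 - prob (space M - {\<omega> \<in> space M. (\<Sum>k<N. u \<bullet> Y k \<omega>) / sqrt (N * \<sigma>\<^sup>2) \<le> 1 / \<sigma>})"
      by (simp add: prob_compl)
    also have "space M - {\<omega> \<in> space M. (\<Sum>k<N. u \<bullet> Y k \<omega>) / sqrt (N * \<sigma>\<^sup>2) \<le> 1 / \<sigma>}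
        = {\<omega> \<in> space M. sqrt N < u \<bullet> S N \<omega>}"
      using \<sigma>(1) elim(2)
      by (auto simp: S_def inner_sum_right real_sqrt_mult field_simps not_le)
    finally show ?case using elim(1) by simp
  qed
  then show ?thesis using c(1) by blast
qed

text \<open>
  The number of steps from which the central limit theorem takes effect depends on the direction.
  Chebyshev's inequality extends the bound from one direction to a ball around it, at the price of
  halving the advance and the probability, and finitely many such balls cover the sphere.
\<close>
lemma uniform_prob_step_in_direction:
  "\<exists>c>0. \<forall>\<^sub>F N in sequentially. \<forall>u. norm u = 1 \<longrightarrow>
     c \<le> prob {\<omega> \<in> space M. sqrt N / 2 \<le> u \<bullet> S N \<omega>}"
proof -
  have local: "\<exists>c r. 0 < c \<and> 0 < r \<and> (\<forall>\<^sub>F N in sequentially. \<forall>d\<in>ball u r.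
      c \<le> prob {\<omega> \<in> space M. sqrt N / 2 \<le> d \<bullet> S N \<omega>})" if u: "norm u = 1" for u
  proof -
    obtain c where c: "0 < c" "\<forall>\<^sub>F N in sequentially. c \<le> prob {\<omega> \<in> space M. sqrt N < u \<bullet> S N \<omega>}"
      using eventually_prob_step_in_direction[of u] u by fastforce
    \<comment> \<open>The radius for which Chebyshev's inequality bounds the loss by half of \<open>c\<close>.\<close>
    define r where "r = sqrt (c / (8 * total_variance))"
    have r: "0 < r" "r\<^sup>2 = c / (8 * total_variance)" using c(1) total_variance_pos by (simp_all add: r_def)
    have "\<forall>\<^sub>F N in sequentially. \<forall>d\<in>ball u r. c / 2 \<le> prob {\<omega> \<in> space M. sqrt N / 2 \<le> d \<bullet> S N \<omega>}"
      using c(2) eventually_gt_at_top[of 0]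
    proof eventually_elim
      case (elim N)
      show ?case
      proof
        fix d assume d: "d \<in> ball u r"
        define t where "t = sqrt N / (2 * r)"
        have t: "0 < t" "t\<^sup>2 = N / (4 * r\<^sup>2)"
          using r(1) elim(2) by (simp_all add: t_def power_divide power_mult_distrib)
        have "{\<omega> \<in> space M. sqrt N < u \<bullet> S N \<omega>} \<subseteq>
            {\<omega> \<in> space M. sqrt N / 2 \<le> d \<bullet> S N \<omega>} \<union> {\<omega> \<in> space M. t \<le> norm (\<Sum>k\<in>{..<N}. Y k \<omega>)}"
        proof
          fix \<omega> assume \<omega>: "\<omega> \<in> {\<omega> \<in> space M. sqrt N < u \<bullet> S N \<omega>}"
          show "\<omega> \<in> {\<omega> \<in> space M. sqrt N / 2 \<le> d \<bullet> S N \<omega>} \<union> {\<omega> \<in> space M. t \<le> norm (\<Sum>k\<in>{..<N}. Y k \<omega>)}"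
          proof (cases "t \<le> norm (S N \<omega>)")
            case False
            have "(u - d) \<bullet> S N \<omega> \<le> norm (u - d) * norm (S N \<omega>)" by (rule norm_cauchy_schwarz)
            also have "\<dots> \<le> r * t"
              using d False r(1) by (intro mult_mono) (auto simp: dist_norm)
            also have "\<dots> = sqrt N / 2" using r(1) by (simp add: t_def)
            finally show ?thesis using \<omega> by (auto simp: inner_diff_left)
          qed (use \<omega> in \<open>auto simp: S_def\<close>)
        qed
        then have "prob {\<omega> \<in> space M. sqrt N < u \<bullet> S N \<omega>} \<le>
            prob ({\<omega> \<in> space M. sqrt N / 2 \<le> d \<bullet> S N \<omega>} \<union> {\<omega> \<in> space M. t \<le> norm (\<Sum>k\<in>{..<N}. Y k \<omega>)})"
          by (intro finite_measure_mono) auto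
        also have "\<dots> \<le> prob {\<omega> \<in> space M. sqrt N / 2 \<le> d \<bullet> S N \<omega>} + prob {\<omega> \<in> space M. t \<le> norm (\<Sum>k\<in>{..<N}. Y k \<omega>)}"
          by (intro measure_Un_le) auto
        finally have "prob {\<omega> \<in> space M. sqrt N < u \<bullet> S N \<omega>} \<le>
            prob {\<omega> \<in> space M. sqrt N / 2 \<le> d \<bullet> S N \<omega>} + prob {\<omega> \<in> space M. t \<le> norm (\<Sum>k\<in>{..<N}. Y k \<omega>)}" .
        moreover have "prob {\<omega> \<in> space M. t \<le> norm (\<Sum>k\<in>{..<N}. Y k \<omega>)} \<le> c / 2"
        proof -
          have "prob {\<omega> \<in> space M. t \<le> norm (\<Sum>k\<in>{..<N}. Y k \<omega>)} \<le> N * total_variance / t\<^sup>2"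
            using prob_norm_sum_ge[of "{..<N}" t] t(1) by simp
          also have "\<dots> = c / 2"
            using elim(2) r(1) total_variance_pos by (simp add: t(2) r(2))
          finally show ?thesis .
        qed
        ultimately show "c / 2 \<le> prob {\<omega> \<in> space M. sqrt N / 2 \<le> d \<bullet> S N \<omega>}"
          using elim(1) by linarith
      qed
    qed
    then show ?thesis using c(1) r(1) by (intro exI[of _ "c / 2"] exI[of _ r]) simp
  qed
  then have "\<forall>u\<in>{u. norm u = 1}. \<exists>q. 0 < fst q \<and> 0 < snd q \<and> (\<forall>\<^sub>F N in sequentially. \<forall>d\<in>ball u (snd q).
      fst q \<le> prob {\<omega> \<in> space M. sqrt N / 2 \<le> d \<bullet> S N \<omega>})"
    by simp
  from bchoice[OF this] obtain q where q: "\<And>u. norm u = 1 \<Longrightarrow> 0 < fst (q u) \<and> 0 < snd (q u) \<and>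
      (\<forall>\<^sub>F N in sequentially. \<forall>d\<in>ball u (snd (q u)).
        fst (q u) \<le> prob {\<omega> \<in> space M. sqrt N / 2 \<le> d \<bullet> S N \<omega>})"
    by auto
  define c r where "c u = fst (q u)" and "r u = snd (q u)" for u
  have cr: "0 < c u" "0 < r u"
    "\<forall>\<^sub>F N in sequentially. \<forall>d\<in>ball u (r u). c u \<le> prob {\<omega> \<in> space M. sqrt N / 2 \<le> d \<bullet> S N \<omega>}"
    if "norm u = 1" for u
    using q[OF that] by (simp_all add: c_def r_def)
  have "sphere (0::'a) 1 \<subseteq> (\<Union>u\<in>sphere 0 1. ball u (r u))" using cr(2) by fastforce
  then obtain U where U: "U \<subseteq> sphere (0::'a) 1" "finite U" "sphere (0::'a) 1 \<subseteq> (\<Union>u\<in>U. ball u (r u))"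
    by (rule compactE_image[OF compact_sphere[of "0::'a" 1] open_ball])
  define c' where "c' = Min (insert 1 (c ` U))"
  have "0 < c'" using U(1,2) cr(1) by (auto simp: c'_def)
  moreover have "\<forall>\<^sub>F N in sequentially. \<forall>u\<in>U. \<forall>d\<in>ball u (r u).
      c u \<le> prob {\<omega> \<in> space M. sqrt N / 2 \<le> d \<bullet> S N \<omega>}"
    using U(1,2) cr(3) by (auto simp: eventually_ball_finite_distrib)
  then have "\<forall>\<^sub>F N in sequentially. \<forall>u. norm u = 1 \<longrightarrow>
     c' \<le> prob {\<omega> \<in> space M. sqrt N / 2 \<le> u \<bullet> S N \<omega>}"
  proof eventually_elim
    case (elim N)
    show ?case
    proof (intro allI impI)
      fix d :: 'a assume "norm d = 1"
      then obtain u where u: "u \<in> U" "d \<in> ball u (r u)" using U(3) by auto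
      have "c' \<le> c u" unfolding c'_def using U(2) u(1) by (intro Min_le) auto
      then show "c' \<le> prob {\<omega> \<in> space M. sqrt N / 2 \<le> d \<bullet> S N \<omega>}" using elim u by fastforce
    qed
  qed
  ultimately show ?thesis by blast
qed

lemma near_step_pred: "block_predicate N (near_step N R \<delta> v :: (nat \<Rightarrow> 'a) \<Rightarrow> bool)"
  unfolding near_step_def
proof (rule block_predicateI)
  show "Measurable.pred (PiM {..<N} (\<lambda>_. borel))
      (\<lambda>f. norm ((\<Sum>k<N. f k) - sqrt N *\<^sub>R v) \<le> \<delta> * sqrt N \<and> (\<forall>n\<le>N. norm (\<Sum>k<n. f k :: 'a) \<le> R * sqrt N))"
    by (intro pred_intros_logic pred_intros_finite borel_measurable_le borel_measurable_diff
        borel_measurable_norm measurable_partial_sum borel_measurable_const) auto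
qed (auto simp: partial_sum_restrict)

text \<open>
  The wanted block has two properties: it advances in the given direction, and it stays in a ball.
  The second one fails with probability at most half of the probability of the first one, if the
  radius of the ball is chosen accordingly. The ball is covered by finitely many cells, and the
  centre \<open>v\<close> of a cell that receives its share of the probability is chosen; it inherits an advance
  of \<open>1/2 - \<delta>\<close> from any point of the event in that cell.
\<close>
lemma near_step_available:
  assumes \<delta>: "0 < \<delta>" "\<delta> \<le> 1 / 4"
  shows "\<exists>R c. 0 \<le> R \<and> 0 < c \<and> (\<forall>\<^sub>F N in sequentially. \<forall>d::'a. \<exists>v. norm v \<le> R \<and> 1 / 4 * norm d \<le> v \<bullet> d \<and>
     c \<le> prob {\<omega> \<in> space M. near_step N R \<delta> v (\<lambda>k. Y k \<omega>)})"
proof -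
  obtain c where c: "0 < c" and ev: "\<forall>\<^sub>F N in sequentially. \<forall>u. norm u = 1 \<longrightarrow>
     c \<le> prob {\<omega> \<in> space M. sqrt N / 2 \<le> u \<bullet> S N \<omega>}"
    using uniform_prob_step_in_direction by blast
  \<comment> \<open>The maximal inequality then bounds the probability of leaving the ball of radius \<open>R\<close> by
    \<open>c / 2\<close>; the minimum with \<open>1\<close> makes its hypothesis \<open>2 * total_variance \<le> r\<^sup>2\<close> hold.\<close>
  define r where "r = sqrt (4 * total_variance / min c 1)"
  define R where "R = 2 * r"
  have r: "0 < r" "r\<^sup>2 = 4 * total_variance / min c 1" using c total_variance_pos by (simp_all add: r_def)
  have "total_variance / (min c 1) \<ge> total_variance" using c total_variance_pos by (simp add: field_simps)
  then have r_var: "2 * total_variance \<le> r\<^sup>2" using r(2) total_variance_pos by simp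
  have "2 * total_variance / r\<^sup>2 = min c 1 / 2" using c total_variance_pos by (simp add: r(2))
  then have rc: "2 * total_variance / r\<^sup>2 \<le> c / 2" by simp
  obtain U where U: "finite U" "U \<subseteq> cball 0 R" "cball (0::'a) R \<subseteq> (\<Union>v\<in>U. ball v \<delta>)"
    using compact_imp_seq_compact[THEN seq_compact_imp_totally_bounded, of "cball (0::'a) R"] \<delta>(1)
    by (auto simp: compact_cball)
  have Une: "U \<noteq> {}" using U(3) r(1) by (auto simp: R_def)
  define c' where "c' = c / 2 / card U"
  have c': "0 < c'" using c U(1) Une by (simp add: c'_def card_gt_0_iff)
  have "\<forall>\<^sub>F N in sequentially. \<forall>d::'a. \<exists>v. norm v \<le> R \<and> 1 / 4 * norm d \<le> v \<bullet> d \<and>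
     c' \<le> prob {\<omega> \<in> space M. near_step N R \<delta> v (\<lambda>k. Y k \<omega>)}"
    using ev eventually_gt_at_top[of 0]
  proof eventually_elim
    case (elim N)
    have N: "0 < sqrt N" using elim(2) by simp
    have unit: "\<exists>v. norm v \<le> R \<and> 1 / 4 \<le> v \<bullet> u \<and> c' \<le> prob {\<omega> \<in> space M. near_step N R \<delta> v (\<lambda>k. Y k \<omega>)}"
      if u: "norm u = 1" for u
    proof -
      define G where "G = {\<omega> \<in> space M. sqrt N / 2 \<le> u \<bullet> S N \<omega> \<and> (\<forall>n\<le>N. norm (S n \<omega>) \<le> R * sqrt N)}"
      define E where "E v = {\<omega> \<in> space M. near_step N R \<delta> v (\<lambda>k. Y k \<omega>)}" for v
      have [measurable]: "G \<in> sets M" unfolding G_def by measurable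
      have E_sets [measurable]: "E v \<in> sets M" for v
        unfolding E_def near_step_def S_def[symmetric] by measurable
      have "prob {\<omega> \<in> space M. \<exists>n\<le>N. 2 * (r * sqrt N) < norm (S n \<omega>)} \<le> 2 * N * total_variance / (r * sqrt N)\<^sup>2"
        using elim(2) r(1) r_var by (intro maximal_inequality) (auto simp: power_mult_distrib)
      also have "\<dots> = 2 * total_variance / r\<^sup>2" using elim(2) by (simp add: power_mult_distrib)
      finally have small: "prob {\<omega> \<in> space M. \<exists>n\<le>N. R * sqrt N < norm (S n \<omega>)} \<le> c / 2"
        using rc by (simp add: R_def mult.assoc)
      have "c \<le> prob {\<omega> \<in> space M. sqrt N / 2 \<le> u \<bullet> S N \<omega>}" using elim(1) u by blast
      also have "\<dots> \<le> prob (G \<union> {\<omega> \<in> space M. \<exists>n\<le>N. R * sqrt N < norm (S n \<omega>)})"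
        by (intro finite_measure_mono) (auto simp: G_def not_less)
      also have "\<dots> \<le> prob G + prob {\<omega> \<in> space M. \<exists>n\<le>N. R * sqrt N < norm (S n \<omega>)}"
        by (intro measure_Un_le) auto
      finally have G: "c / 2 \<le> prob G" using small by linarith
      have cover: "G \<subseteq> (\<Union>v\<in>U. G \<inter> E v)"
      proof
        fix \<omega> assume \<omega>: "\<omega> \<in> G"
        define x where "x = (1 / sqrt N) *\<^sub>R S N \<omega>"
        have x: "S N \<omega> = sqrt N *\<^sub>R x" using N by (simp add: x_def)
        have "norm (S N \<omega>) \<le> R * sqrt N" using \<omega> by (auto simp: G_def)
        then have "norm x \<le> R" using N by (simp add: x)
        then obtain v where v: "v \<in> U" "norm (x - v) < \<delta>"
          using U(3) by (force simp: dist_norm norm_minus_commute)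
        have "norm (S N \<omega> - sqrt N *\<^sub>R v) \<le> \<delta> * sqrt N"
          using v(2) N by (simp add: x flip: scaleR_diff_right)
        then have "\<omega> \<in> E v" using \<omega> by (auto simp: E_def G_def near_step_def S_def)
        then show "\<omega> \<in> (\<Union>v\<in>U. G \<inter> E v)" using v \<omega> by blast
      qed
      have "\<exists>v\<in>U. c' \<le> prob (G \<inter> E v)"
      proof (rule ccontr)
        assume "\<not> ?thesis"
        then have "(\<Sum>v\<in>U. prob (G \<inter> E v)) < (\<Sum>v\<in>U. c')"
          using U(1) Une by (intro sum_strict_mono) (auto simp: not_le)
        also have "\<dots> = c / 2" using U(1) Une by (simp add: c'_def)
        finally have "(\<Sum>v\<in>U. prob (G \<inter> E v)) < c / 2" .
        moreover have "prob G \<le> prob (\<Union>v\<in>U. G \<inter> E v)"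
          using cover U(1) by (intro finite_measure_mono sets.finite_UN sets.Int E_sets) auto
        moreover have "\<dots> \<le> (\<Sum>v\<in>U. prob (G \<inter> E v))"
          using U(1) by (intro finite_measure_subadditive_finite) auto
        ultimately show False using G by linarith
      qed
      then obtain v where v: "v \<in> U" "c' \<le> prob (G \<inter> E v)" by blast
      then have "G \<inter> E v \<noteq> {}" using c' by (metis measure_empty not_less)
      then obtain \<omega> where \<omega>: "\<omega> \<in> G" "\<omega> \<in> E v" by blast
      have "sqrt N / 2 \<le> u \<bullet> S N \<omega>" using \<omega>(1) by (simp add: G_def)
      also have "\<dots> = sqrt N * (v \<bullet> u) + u \<bullet> (S N \<omega> - sqrt N *\<^sub>R v)"
        by (simp add: inner_diff_right inner_commute)
      also have "u \<bullet> (S N \<omega> - sqrt N *\<^sub>R v) \<le> norm u * norm (S N \<omega> - sqrt N *\<^sub>R v)"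
        by (rule norm_cauchy_schwarz)
      also have "\<dots> \<le> \<delta> * sqrt N"
        using \<omega>(2) u by (simp add: E_def near_step_def S_def)
      also have "\<dots> \<le> 1 / 4 * sqrt N" using \<delta>(2) by (intro mult_right_mono) auto
      finally have "sqrt N * (1 / 4) \<le> sqrt N * (v \<bullet> u)" by simp
      then have "1 / 4 \<le> v \<bullet> u" using N by (simp only: mult_le_cancel_left_pos)
      moreover have "norm v \<le> R" using U(2) v(1) by auto
      moreover have "c' \<le> prob (E v)"
        using v(2) finite_measure_mono[of "G \<inter> E v" "E v"] by simp
      ultimately show ?thesis unfolding E_def by blast
    qed
    show ?case
    proof
      fix d :: 'a
      obtain u :: 'a where u: "norm u = 1" "d = norm d *\<^sub>R u"
      proof (cases "d = 0")
        case True
        then show ?thesis using that[of "SOME b. b \<in> Basis"] by (simp add: some_in_eq)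
      next
        case False
        then show ?thesis using that[of "d /\<^sub>R norm d"] by simp
      qed
      obtain v where v: "norm v \<le> R" "1 / 4 \<le> v \<bullet> u"
          "c' \<le> prob {\<omega> \<in> space M. near_step N R \<delta> v (\<lambda>k. Y k \<omega>)}"
        using unit[OF u(1)] by blast
      have "1 / 4 * norm d \<le> (v \<bullet> u) * norm d" using v(2) by (intro mult_right_mono) auto
      also have "\<dots> = v \<bullet> d" by (subst (2) u(2)) simp
      finally show "\<exists>v. norm v \<le> R \<and> 1 / 4 * norm d \<le> v \<bullet> d \<and>
          c' \<le> prob {\<omega> \<in> space M. near_step N R \<delta> v (\<lambda>k. Y k \<omega>)}"
        using v by blast
    qed
  qed
  then show ?thesis using r(1) c' by (intro exI[of _ R] exI[of _ c']) (simp add: R_def)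
qed

end

section \<open>The walk follows every curve infinitely often\<close>

lemma disjoint_blocks:
  fixes p n :: "nat \<Rightarrow> nat"
  assumes "\<And>i. p i + n i \<le> p (Suc i)"
  shows "disjoint_family_on (\<lambda>i. {p i..<p i + n i}) I"
proof -
  have "p i \<le> p (Suc i)" for i using assms[of i] by simp
  then have mono: "p i \<le> p j" if "i \<le> j" for i j
    using that by (rule lift_Suc_mono_le)
  have less: "{p i..<p i + n i} \<inter> {p j..<p j + n j} = {}" if "i < j" for i j
    using mono[of "Suc i" j] that assms[of i] by auto
  show ?thesis
    unfolding disjoint_family_on_def
  proof (intro ballI impI)
    fix i j :: nat assume "i \<noteq> j"
    then consider "i < j" | "j < i" by linarith
    then show "{p i..<p i + n i} \<inter> {p j..<p j + n j} = {}"
      using less[of i j] less[of j i] by cases auto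
  qed
qed

text \<open>
  The probability of the limit superior is at least \<open>c\<close> by continuity from above, and it is \<open>0\<close> or
  \<open>1\<close> by the zero-one law.
\<close>
lemma (in prob_space) infinitely_often_if_indep_prob_ge:
  assumes indep: "indep_events (\<lambda>j. {\<omega> \<in> space M. P j \<omega>}) UNIV"
    and c: "0 < c" "\<And>j. c \<le> prob {\<omega> \<in> space M. P j \<omega>}"
  shows "AE \<omega> in M. \<exists>\<^sub>F j in sequentially. P j \<omega>"
proof -
  define U where "U n = (\<Union>j\<in>{n..}. {\<omega> \<in> space M. P j \<omega>})" for n :: nat
  have sets [measurable]: "{\<omega> \<in> space M. P j \<omega>} \<in> sets M" for j
    using indep by (auto simp: indep_events_def)
  have U_sets [measurable]: "U n \<in> sets M" for n unfolding U_def by measurable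
  have "decseq U" unfolding decseq_def U_def by (intro allI impI UN_mono) auto
  then have "(\<lambda>n. prob (U n)) \<longlonglongrightarrow> prob (\<Inter>n. U n)"
    by (intro finite_Lim_measure_decseq) auto
  moreover have "c \<le> prob (U n)" for n
  proof -
    have "prob {\<omega> \<in> space M. P n \<omega>} \<le> prob (U n)"
      by (intro finite_measure_mono U_sets) (auto simp: U_def)
    then show ?thesis using c(2)[of n] by linarith
  qed
  ultimately have "c \<le> prob (\<Inter>n. U n)" by (intro LIMSEQ_le_const) auto
  then have "prob (\<Inter>n. U n) = 1" using borel_0_1_law[OF indep] c(1) by (auto simp: U_def)
  then have "AE \<omega> in M. \<omega> \<in> (\<Inter>n. U n)" by (subst (asm) prob_eq_1) auto
  then show ?thesis
  proof eventually_elim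
    case (elim \<omega>)
    then show ?case by (auto simp: U_def frequently_sequentially)
  qed
qed

context centered_iid_steps
begin

lemma prob_near_steps:
  fixes m N p :: nat
  assumes c: "0 \<le> c" "\<And>i. i < m \<Longrightarrow> c \<le> prob {\<omega> \<in> space M. near_step N R \<delta> (v i) (\<lambda>k. Y k \<omega>)}"
  shows "c ^ m \<le> prob {\<omega> \<in> space M. \<forall>i<m. near_step N R \<delta> (v i) (\<lambda>k. Y (p + (i * N + k)) \<omega>)}"
proof (cases "m = 0")
  case True
  then show ?thesis by (simp add: prob_space)
next
  case False
  define F where "F i = {\<omega> \<in> space M. near_step N R \<delta> (v i) (\<lambda>k. Y ((p + i * N) + k) \<omega>)}" for i
  have "indep_events F {..<m}"
    unfolding F_def
    by (intro indep_events_blocks[where n = "\<lambda>_. N"] disjoint_blocks near_step_pred) simp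
  then have "prob (\<Inter>i\<in>{..<m}. F i) = (\<Prod>i<m. prob (F i))"
    unfolding indep_events_def using False by (auto simp: lessThan_empty_iff)
  moreover have "(\<Inter>i\<in>{..<m}. F i) = {\<omega> \<in> space M. \<forall>i<m. near_step N R \<delta> (v i) (\<lambda>k. Y (p + (i * N + k)) \<omega>)}"
    using False by (auto simp: F_def add.assoc)
  moreover have "prob (F i) = prob {\<omega> \<in> space M. near_step N R \<delta> (v i) (\<lambda>k. Y k \<omega>)}" for i
    unfolding F_def by (rule prob_block[OF near_step_pred])
  moreover have "(\<Prod>i<m. c) \<le> (\<Prod>i<m. prob {\<omega> \<in> space M. near_step N R \<delta> (v i) (\<lambda>k. Y k \<omega>)})"
    using c by (intro prod_mono) auto
  ultimately show ?thesis by simp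
qed

lemma near_steps_pred:
  fixes m N :: nat
  shows "block_predicate (m * N) (\<lambda>f. \<forall>i<m. near_step N R \<delta> (v i :: 'a) (\<lambda>k. f (i * N + k)))"
proof (rule block_predicateI)
  have inside: "i * N + k < m * N" if "i < m" "k < N" for i k
  proof -
    have "i * N + k < Suc i * N" using that by simp
    also have "\<dots> \<le> m * N" using that by (intro mult_le_mono1) simp
    finally show ?thesis .
  qed
  have meas: "(\<lambda>f. \<Sum>k<n. f (i * N + k)) \<in> PiM {..<m * N} (\<lambda>_. borel :: 'a measure) \<rightarrow>\<^sub>M borel"
    if "i < m" "n \<le> N" for i n
  proof (rule borel_measurable_sum, rule measurable_component_singleton)
    fix k assume "k \<in> {..<n}"
    then have "k < N" using that(2) by simp
    from inside[OF that(1) this] show "i * N + k \<in> {..<m * N}" by simp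
  qed
  show "Measurable.pred (PiM {..<m * N} (\<lambda>_. borel)) (\<lambda>f. \<forall>i<m. near_step N R \<delta> (v i :: 'a) (\<lambda>k. f (i * N + k)))"
  proof -
    have [measurable]: "Measurable.pred (PiM {..<m * N} (\<lambda>_. borel)) (\<lambda>f. near_step N R \<delta> (v i :: 'a) (\<lambda>k. f (i * N + k)))"
      if i: "i \<in> {..<m}" for i
    proof -
      have [measurable]: "(\<lambda>f. \<Sum>k<n. f (i * N + k)) \<in> PiM {..<m * N} (\<lambda>_. borel :: 'a measure) \<rightarrow>\<^sub>M borel"
        if "n \<in> {..N}" for n
        using meas[of i n] i that by simp
      have [measurable]: "(\<lambda>f. \<Sum>k<N. f (i * N + k)) \<in> PiM {..<m * N} (\<lambda>_. borel :: 'a measure) \<rightarrow>\<^sub>M borel"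
        using meas[of i N] i by simp
      have "Measurable.pred (PiM {..<m * N} (\<lambda>_. borel :: 'a measure)) (\<lambda>f. norm ((\<Sum>k<N. f (i * N + k)) - sqrt N *\<^sub>R v i) \<le> \<delta> * sqrt N \<and>
          (\<forall>n\<in>{..N}. norm (\<Sum>k<n. f (i * N + k)) \<le> R * sqrt N))"
        by measurable
      then show ?thesis unfolding near_step_def by (simp only: Ball_def atMost_iff)
    qed
    have "Measurable.pred (PiM {..<m * N} (\<lambda>_. borel)) (\<lambda>f. \<forall>i\<in>{..<m}. near_step N R \<delta> (v i :: 'a) (\<lambda>k. f (i * N + k)))"
      by measurable
    then show ?thesis by (simp only: Ball_def lessThan_iff)
  qed
  show "(\<forall>i<m. near_step N R \<delta> (v i) (\<lambda>k. restrict f {..<m * N} (i * N + k))) =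
      (\<forall>i<m. near_step N R \<delta> (v i) (\<lambda>k. f (i * N + k)))" for f :: "nat \<Rightarrow> 'a"
  proof -
    have "(\<Sum>k<n. restrict f {..<m * N} (i * N + k)) = (\<Sum>k<n. f (i * N + k))"
      if "i < m" "n \<le> N" for i n
    proof (rule sum.cong)
      fix k assume "k \<in> {..<n}"
      then have "k < N" using that(2) by simp
      from inside[OF that(1) this] have "i * N + k < m * N" .
      then show "restrict f {..<m * N} (i * N + k) = f (i * N + k)" by simp
    qed simp
    then show ?thesis unfolding near_step_def by simp
  qed
qed

text \<open>
  The constants are chosen in this order: the precision \<open>\<delta>\<close> of a move, at most a small multiple of
  \<open>\<rho> / \<Lambda>\<close>, so that the accumulated error \<open>m \<delta>\<close> is small compared with \<open>\<rho> \<kappa>\<close>, where the size \<open>\<kappa>\<close>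
  of the drawing is proportional to \<open>m / \<Lambda>\<close>; then the radius \<open>R\<close>, the probability \<open>c\<close> and the
  tracking distance \<open>C\<close>, which depend on \<open>\<delta>\<close> only; then the number \<open>m\<close> of blocks, so large that
  \<open>C + R\<close> is small compared with \<open>\<rho> \<kappa>\<close>; and last the block lengths \<open>N\<close>, on which the lower bound
  \<open>c ^ m\<close> for the probability of success does not depend.
\<close>
theorem walk_tracks_curve:
  fixes \<gamma> :: "real \<Rightarrow> 'a"
  assumes lip: "\<And>t u. t \<in> {0..1} \<Longrightarrow> u \<in> {0..1} \<Longrightarrow> norm (\<gamma> t - \<gamma> u) \<le> \<Lambda> * \<bar>t - u\<bar>"
    and \<gamma>0: "\<gamma> 0 = 0" and \<Lambda>: "0 < \<Lambda>" and \<rho>: "0 < \<rho>"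
  shows "AE \<omega> in M. \<exists>\<^sub>F n in sequentially. \<exists>s>0. tracks \<rho> s \<gamma> ((\<lambda>n. S n \<omega>) ` {0..n})"
proof -
  define \<delta> where "\<delta> = min (1 / 4) (\<rho> / (64 * \<Lambda>))"
  have \<delta>: "0 < \<delta>" "\<delta> \<le> 1 / 4" "\<delta> \<le> \<rho> / (64 * \<Lambda>)" using \<rho> \<Lambda> by (simp_all add: \<delta>_def)
  obtain R c where Rc: "0 \<le> R" "0 < c" and "\<forall>\<^sub>F N in sequentially. \<forall>d::'a. \<exists>v. norm v \<le> R \<and>
      1 / 4 * norm d \<le> v \<bullet> d \<and> c \<le> prob {\<omega> \<in> space M. near_step N R \<delta> v (\<lambda>k. Y k \<omega>)}"
    using near_step_available[OF \<delta>(1,2)] by blast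
  then obtain N0 where N0: "\<And>N. N0 \<le> N \<Longrightarrow> \<forall>d::'a. \<exists>v. norm v \<le> R \<and>
      1 / 4 * norm d \<le> v \<bullet> d \<and> c \<le> prob {\<omega> \<in> space M. near_step N R \<delta> v (\<lambda>k. Y k \<omega>)}"
    unfolding eventually_sequentially by blast
  \<comment> \<open>The distance at which a target of speed at most \<open>1/8\<close> can be followed.\<close>
  define C where "C = R\<^sup>2 / (1 / 4) + R + 1 / 4"
  have C: "0 \<le> C" using Rc by (simp add: C_def)
  obtain m :: nat where m: "(64 * \<Lambda> * (C + R) + 4 * \<Lambda>) / \<rho> < m"
    using reals_Archimedean2 by blast
  have m_bound: "64 * \<Lambda> * (C + R) + 4 * \<Lambda> < \<rho> * m" using m \<rho> by (simp add: field_simps)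
  moreover have "0 \<le> 64 * \<Lambda> * (C + R)" using \<Lambda> C Rc by simp
  ultimately have mesh: "\<Lambda> \<le> \<rho> * m / 4" and large: "64 * \<Lambda> * (C + R) \<le> \<rho> * m" and "0 < \<rho> * m"
    using \<Lambda> by linarith+
  then have m0: "0 < m" using \<rho> by (simp add: zero_less_mult_iff)
  define \<kappa> where "\<kappa> = m / (8 * \<Lambda>)"
  have \<kappa>: "0 < \<kappa>" using m0 \<Lambda> by (simp add: \<kappa>_def)
  have error: "C + m * \<delta> + R \<le> \<rho> * \<kappa> / 4"
  proof -
    have "C + R \<le> \<rho> * \<kappa> / 8" using large \<Lambda> by (simp add: \<kappa>_def field_simps)
    moreover have "m * \<delta> \<le> m * (\<rho> / (64 * \<Lambda>))" using \<delta>(3) by (intro mult_left_mono) auto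
    moreover have "m * (\<rho> / (64 * \<Lambda>)) = \<rho> * \<kappa> / 8" by (simp add: \<kappa>_def)
    ultimately show ?thesis by linarith
  qed
  define x where "x i = \<kappa> *\<^sub>R \<gamma> (min 1 (i / m))" for i :: nat
  have x0: "x 0 = 0" using \<gamma>0 by (simp add: x_def)
  have slow: "norm (x (Suc i) - x i) \<le> (1 / 4) / 2" for i
  proof -
    have "real (Suc i) / m = real i / m + 1 / m" by (simp add: add_divide_distrib)
    moreover have "0 \<le> 1 / real m" by simp
    ultimately have "\<bar>min 1 (real (Suc i) / m) - min 1 (real i / m)\<bar> \<le> 1 / m" by linarith
    then have "norm (\<gamma> (min 1 (real (Suc i) / m)) - \<gamma> (min 1 (real i / m))) \<le> \<Lambda> * (1 / m)"
      using lip[of "min 1 (real (Suc i) / m)" "min 1 (real i / m)"] \<Lambda>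
      by (smt (verit, best) atLeastAtMost_iff divide_nonneg_nonneg mult_left_mono of_nat_0_le_iff)
    then have "\<kappa> * norm (\<gamma> (min 1 (real (Suc i) / m)) - \<gamma> (min 1 (real i / m))) \<le> \<kappa> * (\<Lambda> * (1 / m))"
      using \<kappa> by (intro mult_left_mono) auto
    also have "\<dots> = 1 / 8" using m0 \<Lambda> by (simp add: \<kappa>_def)
    finally show ?thesis using \<kappa> by (simp add: x_def flip: scaleR_diff_right)
  qed
  have "\<exists>v. (\<forall>i. c \<le> prob {\<omega> \<in> space M. near_step N R \<delta> (v i) (\<lambda>k. Y k \<omega>)}) \<and>
      (\<forall>i. norm ((\<Sum>l<i. v l) - x i) \<le> C)" if "N0 \<le> N" for N
  proof -
    \<comment> \<open>The moves at hand when blocks have length \<open>N\<close>.\<close>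
    define V where "V = {v. norm v \<le> R \<and> c \<le> prob {\<omega> \<in> space M. near_step N R \<delta> v (\<lambda>k. Y k \<omega>)}}"
    have "\<exists>v\<in>V. 1 / 4 * norm d \<le> v \<bullet> d" for d using N0[OF that] unfolding V_def by blast
    then have "\<exists>v. (\<forall>i. v i \<in> V) \<and> (\<forall>i. norm ((\<Sum>l<i. v l) - x i) \<le> C)"
      unfolding C_def using x0 slow by (intro steering) (auto simp: V_def)
    then show ?thesis unfolding V_def by blast
  qed
  then obtain v where v: "\<And>N i. N0 \<le> N \<Longrightarrow> c \<le> prob {\<omega> \<in> space M. near_step N R \<delta> (v N i) (\<lambda>k. Y k \<omega>)}"
      "\<And>N i. N0 \<le> N \<Longrightarrow> norm ((\<Sum>l<i. v N l) - x i) \<le> C"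
    by metis
  have "\<exists>N. N0 \<le> N \<and> 0 < N \<and>
      prob {\<omega> \<in> space M. \<exists>n\<le>p. \<rho> * \<kappa> / 4 * sqrt N < norm (S n \<omega>)} \<le> (1 / 2) ^ j" for p j :: nat
  proof -
    define e where "e = (\<rho> * \<kappa> / 8)\<^sup>2"
    have e: "0 < e" using \<rho> \<kappa> by (simp add: e_def)
    obtain N1 :: nat where N1: "2 * p * total_variance * 2 ^ j / e < N1" using reals_Archimedean2 by blast
    define N where "N = Suc (max N0 N1)"
    define r where "r = \<rho> * \<kappa> / 8 * sqrt N"
    have "0 < N" by (simp add: N_def)
    then have r: "0 < r" using \<rho> \<kappa> by (simp add: r_def)
    have r2: "r\<^sup>2 = e * N" unfolding r_def e_def power_mult_distrib by simp
    have "2 * p * total_variance * 2 ^ j / e \<le> N" using N1 by (simp add: N_def)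
    then have pj: "2 * p * total_variance * 2 ^ j \<le> r\<^sup>2" using e by (simp add: r2 field_simps)
    have "2 * p * total_variance * 1 \<le> 2 * p * total_variance * 2 ^ j" using total_variance_pos by (intro mult_left_mono) auto
    then have "prob {\<omega> \<in> space M. \<exists>n\<le>p. 2 * r < norm (S n \<omega>)} \<le> 2 * p * total_variance / r\<^sup>2"
      using pj r by (intro maximal_inequality) auto
    also have "\<dots> \<le> (1 / 2) ^ j" using pj r by (simp add: field_simps power_one_over)
    finally have "prob {\<omega> \<in> space M. \<exists>n\<le>p. 2 * r < norm (S n \<omega>)} \<le> (1 / 2) ^ j" .
    moreover have "2 * r = \<rho> * \<kappa> / 4 * sqrt N" by (simp add: r_def)
    moreover have "N0 \<le> N" by (simp add: N_def)
    ultimately show ?thesis using \<open>0 < N\<close> by (intro exI[of _ N]) (simp only: simp_thms)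
  qed
  note ex = this
  define g where "g p j = (SOME N. N0 \<le> N \<and> 0 < N \<and>
      prob {\<omega> \<in> space M. \<exists>n\<le>p. \<rho> * \<kappa> / 4 * sqrt N < norm (S n \<omega>)} \<le> (1 / 2) ^ j)" for p j
  have g: "N0 \<le> g p j \<and> 0 < g p j \<and>
      prob {\<omega> \<in> space M. \<exists>n\<le>p. \<rho> * \<kappa> / 4 * sqrt (g p j) < norm (S n \<omega>)} \<le> (1 / 2) ^ j" for p j
    unfolding g_def by (rule someI_ex[OF ex])
  \<comment> \<open>The itinerary number \<open>j\<close> occupies the times from \<open>q j\<close> to \<open>q (Suc j)\<close>, in blocks of length \<open>N j\<close>.\<close>
  define q where "q = rec_nat 0 (\<lambda>j p. p + m * g p j)"
  define N where "N j = g (q j) j" for j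
  have q: "q (Suc j) = q j + m * N j" for j by (simp add: q_def N_def)
  have N: "N0 \<le> N j" "0 < N j"
      "prob {\<omega> \<in> space M. \<exists>n\<le>q j. \<rho> * \<kappa> / 4 * sqrt (N j) < norm (S n \<omega>)} \<le> (1 / 2) ^ j" for j
    using g[of "q j" j] by (simp_all add: N_def)
  define E where "E j \<omega> \<longleftrightarrow> (\<forall>i<m. near_step (N j) R \<delta> (v (N j) i) (\<lambda>k. Y (q j + (i * N j + k)) \<omega>))" for j \<omega>
  have "indep_events (\<lambda>j. {\<omega> \<in> space M. E j \<omega>}) UNIV"
    unfolding E_def
    by (rule indep_events_blocks[where n = "\<lambda>j. m * N j" and p = q
          and Q = "\<lambda>j f. \<forall>i<m. near_step (N j) R \<delta> (v (N j) i) (\<lambda>k. f (i * N j + k))"])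
      (auto simp: q intro: disjoint_blocks near_steps_pred)
  moreover have "c ^ m \<le> prob {\<omega> \<in> space M. E j \<omega>}" for j
    unfolding E_def using Rc v(1) N(1) by (intro prob_near_steps) auto
  ultimately have often: "AE \<omega> in M. \<exists>\<^sub>F j in sequentially. E j \<omega>"
    using Rc(2) by (intro infinitely_often_if_indep_prob_ge[of _ "c ^ m"]) auto
  \<comment> \<open>The past is too large at the scale of the itinerary number \<open>j\<close>.\<close>
  define B where "B j = {\<omega> \<in> space M. \<exists>n\<le>q j. \<rho> * \<kappa> / 4 * sqrt (N j) < norm (S n \<omega>)}" for j
  have "summable (\<lambda>j. prob (B j))"
    by (rule summable_comparison_test'[of "\<lambda>j. (1 / 2 :: real) ^ j" 0])
      (use N(3) in \<open>auto simp: B_def intro!: summable_geometric\<close>)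
  moreover have "B j \<in> sets M" for j unfolding B_def by measurable
  ultimately have rare: "AE \<omega> in M. \<forall>\<^sub>F j in sequentially. \<omega> \<in> space M - B j"
    by (intro borel_cantelli_AE1) (auto simp: emeasure_eq_measure)
  have q_ge: "j \<le> q j" for j
  proof (induction j)
    case (Suc j)
    have "1 * 1 \<le> m * N j" using m0 N(2)[of j] by (intro mult_le_mono) auto
    then show ?case using Suc q[of j] by linarith
  qed simp
  show ?thesis
    using often rare
  proof eventually_elim
    case (elim \<omega>)
    have tracks: "tracks \<rho> (\<kappa> * sqrt (N j)) \<gamma> ((\<lambda>n. S n \<omega>) ` {0..q (Suc j)})"
      if "E j \<omega>" "\<omega> \<in> space M - B j" for j
      unfolding q S_def
    proof (rule tracks_if_near_steps[where f = "\<lambda>k. Y k \<omega>" and v = "v (N j)" and \<Lambda> = \<Lambda>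
            and C = C and R = R and \<delta> = \<delta>])
      show "near_step (N j) R \<delta> (v (N j) i) (\<lambda>k. Y (q j + (i * N j + k)) \<omega>)" if "i < m" for i
        using \<open>E j \<omega>\<close> that by (simp add: E_def)
      show "norm ((\<Sum>l<i. v (N j) l) - \<kappa> *\<^sub>R \<gamma> (min 1 (i / m))) \<le> C" for i
        using v(2)[OF N(1)] by (simp add: x_def)
      show "norm (\<Sum>k<n. Y k \<omega>) \<le> \<rho> * \<kappa> / 4 * sqrt (N j)" if "n \<le> q j" for n
        using \<open>\<omega> \<in> space M - B j\<close> that by (auto simp: B_def S_def not_less)
    qed (use N[of j] m0 \<kappa> \<delta> Rc \<Lambda> \<rho> error mesh in \<open>auto simp: lip \<gamma>0\<close>)
    show ?case
      unfolding frequently_sequentially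
    proof
      fix n0
      obtain j where j: "n0 \<le> j" "E j \<omega>" "\<omega> \<in> space M - B j"
        using frequently_eventually_conj[OF elim] unfolding frequently_sequentially by blast
      have "0 < \<kappa> * sqrt (N j)" using \<kappa> N(2)[of j] by simp
      moreover have "n0 \<le> q (Suc j)" using q_ge[of "Suc j"] j(1) by linarith
      ultimately show "\<exists>n\<ge>n0. \<exists>s>0. tracks \<rho> s \<gamma> ((\<lambda>n. S n \<omega>) ` {0..n})"
        using tracks[OF j(2,3)] by blast
    qed
  qed
qed

end

section \<open>The ratio of perimeter to diameter\<close>

lemma liminf_le_if_frequently:
  fixes f :: "nat \<Rightarrow> ereal"
  assumes "\<And>b. a < b \<Longrightarrow> \<exists>\<^sub>F n in sequentially. f n \<le> b"
  shows "liminf f \<le> a"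
proof (rule ccontr)
  assume "\<not> liminf f \<le> a"
  then have "a < liminf f" by simp
  from dense[OF this] obtain b where b: "a < b" "b < liminf f" by blast
  then have "\<forall>\<^sub>F n in sequentially. b < f n" by (intro less_LiminfD)
  then show False using assms[OF b(1)] by (auto simp: frequently_def not_le)
qed

lemma le_limsup_if_frequently:
  fixes f :: "nat \<Rightarrow> ereal"
  assumes "\<And>b. b < a \<Longrightarrow> \<exists>\<^sub>F n in sequentially. b \<le> f n"
  shows "a \<le> limsup f"
proof (rule ccontr)
  assume "\<not> a \<le> limsup f"
  then have "limsup f < a" by simp
  from dense[OF this] obtain b where b: "b < a" "limsup f < b" by blast
  then have "\<forall>\<^sub>F n in sequentially. f n < b" by (intro Limsup_lessD)
  then show False using assms[OF b(1)] by (auto simp: frequently_def not_le)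
qed

lemma norm_direction_diff_le: "norm (direction a - direction b) \<le> 2 * \<bar>a - b\<bar>"
proof -
  have lip: "\<bar>f a - f b\<bar> \<le> \<bar>a - b\<bar>"
    if "\<And>x. (f has_real_derivative f' x) (at x)" "\<And>x. \<bar>f' x\<bar> \<le> 1" for f f' :: "real \<Rightarrow> real"
    using field_differentiable_bound[of UNIV f f' 1 a b] that by simp
  have "norm (direction a - direction b) \<le> \<bar>cos a - cos b\<bar> + \<bar>sin a - sin b\<bar>"
    using norm_le_l1_cart[of "direction a - direction b"] by (simp add: direction_def sum_2)
  also have "\<dots> \<le> \<bar>a - b\<bar> + \<bar>a - b\<bar>"
  proof (rule add_mono)
    show "\<bar>cos a - cos b\<bar> \<le> \<bar>a - b\<bar>"
      by (rule lip[of cos "\<lambda>x. - sin x"]) (auto intro!: derivative_eq_intros)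
    show "\<bar>sin a - sin b\<bar> \<le> \<bar>a - b\<bar>"
      by (rule lip[of sin cos]) (auto intro!: derivative_eq_intros)
  qed
  finally show ?thesis by simp
qed

lemma inner_outer_square: "u \<bullet> (outer_square z *v u) = (u \<bullet> z)\<^sup>2"
proof -
  have "(outer_square z *v u) $ i = z $ i * (u \<bullet> z)" for i
    by (simp add: outer_square_def matrix_matrix_mult_def matrix_vector_mult_def columnvector_def
        transpose_def inner_vec_def sum_distrib_left algebra_simps)
  then have "outer_square z *v u = (u \<bullet> z) *\<^sub>R z" by (simp add: vec_eq_iff)
  then show ?thesis by (simp add: power2_eq_square)
qed

text \<open>
  The quadratic form of \<open>E (Z Z\<^sup>T)\<close> at \<open>u\<close> is \<open>E ((u \<bullet> Z)\<^sup>2)\<close>, once the matrix is known to be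
  integrable, which follows from the integrability of its entries.
\<close>
lemma (in prob_space) second_moment_positive:
  fixes Z :: "'a \<Rightarrow> real^2"
  assumes [measurable]: "Z \<in> borel_measurable M"
    and sq: "integrable M (\<lambda>\<omega>. (norm (Z \<omega>))\<^sup>2)"
    and pos: "positive_definite (\<integral>\<omega>. outer_square (Z \<omega>) \<partial>M)" and u: "u \<noteq> 0"
  shows "0 < (\<integral>\<omega>. (u \<bullet> Z \<omega>)\<^sup>2 \<partial>M)"
proof -
  let ?A = "\<integral>\<omega>. outer_square (Z \<omega>) \<partial>M"
  have comp: "outer_square z $ i $ j = z $ i * z $ j" for z :: "real^2" and i j
    by (simp add: outer_square_def matrix_matrix_mult_def columnvector_def transpose_def)
  have A: "outer_square z = (\<Sum>i\<in>UNIV. \<Sum>j\<in>UNIV. (z $ i * z $ j) *\<^sub>R axis i (axis j 1))" for z :: "real^2"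
    by (simp add: vec_eq_iff comp forall_2 sum_2 axis_def)
  have int_comp: "integrable M (\<lambda>\<omega>. Z \<omega> $ i * Z \<omega> $ j)" for i j
  proof (rule Bochner_Integration.integrable_bound[OF sq])
    have "(\<lambda>\<omega>. Z \<omega> $ i) \<in> borel_measurable M" for i
      using borel_measurable_inner[of Z M "\<lambda>_. axis i 1"] by (simp add: inner_axis)
    then show "(\<lambda>\<omega>. Z \<omega> $ i * Z \<omega> $ j) \<in> borel_measurable M" by (intro borel_measurable_times)
    have "\<bar>Z \<omega> $ i\<bar> * \<bar>Z \<omega> $ j\<bar> \<le> norm (Z \<omega>) * norm (Z \<omega>)" for \<omega>
      by (intro mult_mono component_le_norm_cart) auto
    then show "AE \<omega> in M. norm (Z \<omega> $ i * Z \<omega> $ j) \<le> norm ((norm (Z \<omega>))\<^sup>2)"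
      by (simp add: abs_mult power2_eq_square)
  qed
  have int: "integrable M (\<lambda>\<omega>. outer_square (Z \<omega>))"
    unfolding A by (intro Bochner_Integration.integrable_sum integrable_scaleR_left int_comp)
  have lin: "bounded_linear (\<lambda>A :: real^2^2. u \<bullet> (A *v u))"
    by (intro bounded_linear_inner_right_comp linear_linear[THEN iffD2] linearI)
      (auto simp: matrix_vector_mult_add_rdistrib scaleR_matrix_vector_assoc)
  have "u \<bullet> (?A *v u) = (\<integral>\<omega>. u \<bullet> (outer_square (Z \<omega>) *v u) \<partial>M)"
    using integral_bounded_linear[OF lin int] by simp
  also have "\<dots> = (\<integral>\<omega>. (u \<bullet> Z \<omega>)\<^sup>2 \<partial>M)" by (simp add: inner_outer_square)
  finally show ?thesis using pos u by (auto simp: positive_definite_def)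
qed

lemma segment_ratio_near_2:
  assumes b: "(2::real) < b"
  shows "\<exists>\<rho>>0. \<rho> < 1 / 2 \<and> (2 + 2 * pi * \<rho>) / (1 - 2 * \<rho>) \<le> b"
proof -
  have "((\<lambda>\<rho>::real. (2 + 2 * pi * \<rho>) / (1 - 2 * \<rho>)) \<longlongrightarrow> (2 + 2 * pi * 0) / (1 - 2 * 0)) (at_right 0)"
    by (intro tendsto_intros) auto
  then have "\<forall>\<^sub>F \<rho> in at_right (0::real). (2 + 2 * pi * \<rho>) / (1 - 2 * \<rho>) < b"
    using b by (intro order_tendstoD) auto
  moreover have "\<forall>\<^sub>F \<rho> in at_right (0::real). 0 < \<rho> \<and> \<rho> < 1 / 2"
    using eventually_at_right_real[of 0 "1 / 2 :: real"] by simp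
  ultimately have "\<forall>\<^sub>F \<rho> in at_right (0::real). 0 < \<rho> \<and> \<rho> < 1 / 2 \<and> (2 + 2 * pi * \<rho>) / (1 - 2 * \<rho>) \<le> b"
    by eventually_elim auto
  then show ?thesis using eventually_happens'[OF trivial_limit_at_right_real] by blast
qed

lemma circle_ratio_near_pi:
  assumes b: "b < pi"
  shows "\<exists>\<rho>>0. \<rho> < 1 \<and> b \<le> pi * (1 - \<rho>) / (1 + \<rho>)"
proof -
  have "((\<lambda>\<rho>::real. pi * (1 - \<rho>) / (1 + \<rho>)) \<longlongrightarrow> pi * (1 - 0) / (1 + 0)) (at_right 0)"
    by (intro tendsto_intros) auto
  then have "\<forall>\<^sub>F \<rho> in at_right (0::real). b < pi * (1 - \<rho>) / (1 + \<rho>)"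
    using b by (intro order_tendstoD) auto
  moreover have "\<forall>\<^sub>F \<rho> in at_right (0::real). 0 < \<rho> \<and> \<rho> < 1"
    using eventually_at_right_real[of 0 "1 :: real"] by simp
  ultimately have "\<forall>\<^sub>F \<rho> in at_right (0::real). 0 < \<rho> \<and> \<rho> < 1 \<and> b \<le> pi * (1 - \<rho>) / (1 + \<rho>)"
    by eventually_elim auto
  then show ?thesis using eventually_happens'[OF trivial_limit_at_right_real] by blast
qed

lemma centered_iid_steps_shift:
  fixes M :: "'w measure" and Z :: "'w \<Rightarrow> real^2" and X :: "nat \<Rightarrow> 'w \<Rightarrow> real^2"
  assumes "prob_space M"
    and Z: "Z \<in> borel_measurable M"
    and indep: "prob_space.indep_vars M (\<lambda>_. borel) X {1..}"
    and ident: "\<And>k. k \<ge> 1 \<Longrightarrow> distr M borel (X k) = distr M borel Z"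
    and sq: "integrable M (\<lambda>\<omega>. (norm (Z \<omega>))\<^sup>2)"
    and pos: "positive_definite (\<integral>\<omega>. outer_square (Z \<omega>) \<partial>M)"
    and mean: "(\<integral>\<omega>. Z \<omega> \<partial>M) = 0"
  shows "centered_iid_steps M (\<lambda>k. X (Suc k))"
proof -
  interpret prob_space M by fact
  note [measurable] = Z
  have [measurable]: "X (Suc 0) \<in> borel_measurable M"
    using indep by (auto simp: indep_vars_def)
  have same: "(\<integral>\<omega>. g (X (Suc 0) \<omega>) \<partial>M) = (\<integral>\<omega>. g (Z \<omega>) \<partial>M)"
    if [measurable]: "g \<in> borel_measurable borel" for g :: "real^2 \<Rightarrow> 'b::{banach, second_countable_topology}"
    using ident[of "Suc 0"] integral_distr[of "X (Suc 0)" M borel g] integral_distr[of Z M borel g] by simp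
  show ?thesis
  proof
    have "indep_vars (\<lambda>i. PiM {Suc i} (\<lambda>_. borel)) (\<lambda>i \<omega>. restrict (\<lambda>k. X k \<omega>) {Suc i}) UNIV"
      by (rule indep_vars_restrict[OF indep]) (auto simp: disjoint_family_on_def)
    moreover have "(\<lambda>f. f (Suc i)) \<in> PiM {Suc i} (\<lambda>_. borel :: (real^2) measure) \<rightarrow>\<^sub>M borel" for i
      by (intro measurable_component_singleton) auto
    ultimately have "indep_vars (\<lambda>_. borel) (\<lambda>i \<omega>. restrict (\<lambda>k. X k \<omega>) {Suc i} (Suc i)) UNIV"
      by (rule indep_vars_compose2)
    then show "indep_vars (\<lambda>_. borel) (\<lambda>k. X (Suc k)) UNIV" by simp
    show "distr M borel (X (Suc k)) = distr M borel (X (Suc 0))" for k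
      using ident[of "Suc k"] ident[of "Suc 0"] by simp
    have "integrable (distr M borel Z) (\<lambda>x. (norm x)\<^sup>2)" using sq by (simp add: integrable_distr_eq)
    then have "integrable (distr M borel (X (Suc 0))) (\<lambda>x. (norm x)\<^sup>2)" using ident[of "Suc 0"] by simp
    then show "integrable M (\<lambda>\<omega>. (norm (X (Suc 0) \<omega>))\<^sup>2)" by (simp add: integrable_distr_eq)
    show "(\<integral>\<omega>. X (Suc 0) \<omega> \<partial>M) = 0" using same[of "\<lambda>x. x"] mean by simp
    show "0 < (\<integral>\<omega>. (u \<bullet> X (Suc 0) \<omega>)\<^sup>2 \<partial>M)" if "u \<noteq> 0" for u
      using same[of "\<lambda>x. (u \<bullet> x)\<^sup>2"] second_moment_positive[OF Z sq pos that] by simp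
  qed
qed

theorem corollary1p6:
  fixes M :: "'w measure"
    and Z :: "'w \<Rightarrow> real^2"
    and X :: "nat \<Rightarrow> 'w \<Rightarrow> real^2"
  assumes "prob_space M"
    and "Z \<in> borel_measurable M"
    and "prob_space.indep_vars M (\<lambda>_. borel) X {1..}"
    and "\<And>k. k \<ge> 1 \<Longrightarrow> distr M borel (X k) = distr M borel Z"
    and "integrable M (\<lambda>\<omega>. (norm (Z \<omega>))\<^sup>2)"
    and "positive_definite (\<integral>\<omega>. outer_square (Z \<omega>) \<partial>M)"
    and "(\<integral>\<omega>. Z \<omega> \<partial>M) = 0"
  shows "AE \<omega> in M.
      2 = liminf (\<lambda>n. ereal (perimeter (walk_hull X n \<omega>) / diameter (walk_hull X n \<omega>)))
    \<and> liminf (\<lambda>n. ereal (perimeter (walk_hull X n \<omega>) / diameter (walk_hull X n \<omega>)))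
        < limsup (\<lambda>n. ereal (perimeter (walk_hull X n \<omega>) / diameter (walk_hull X n \<omega>)))
    \<and> limsup (\<lambda>n. ereal (perimeter (walk_hull X n \<omega>) / diameter (walk_hull X n \<omega>))) = ereal pi"
proof -
  interpret centered_iid_steps M "\<lambda>k. X (Suc k)"
    using assms by (rule centered_iid_steps_shift)
  let ?K = "\<lambda>n \<omega>. walk_hull X n \<omega>"
  let ?r = "\<lambda>n \<omega>. perimeter (?K n \<omega>) / diameter (?K n \<omega>)"
  have S: "walk X n \<omega> = S n \<omega>" for n \<omega>
    unfolding walk_def S_def by (rule sum.reindex_bij_witness[of _ Suc "\<lambda>k. k - 1"]) auto
  have hull: "?K n \<omega> = convex hull ((\<lambda>k. S k \<omega>) ` {0..n})" for n \<omega>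
    by (simp add: walk_hull_def S)
  have poly: "polytope (?K n \<omega>)" "?K n \<omega> \<noteq> {}" for n \<omega>
    by (auto simp: hull polytope_convex_hull)
  define e1 where "e1 = direction 0"
  have thin: "AE \<omega> in M. \<exists>\<^sub>F n in sequentially. 0 < diameter (?K n \<omega>) \<and> ?r n \<omega> \<le> 2 + 1 / Suc i" for i
  proof -
    obtain \<rho> where \<rho>: "0 < \<rho>" "\<rho> < 1 / 2" "(2 + 2 * pi * \<rho>) / (1 - 2 * \<rho>) \<le> 2 + 1 / Suc i"
      using segment_ratio_near_2[of "2 + 1 / Suc i"] by auto
    have "AE \<omega> in M. \<exists>\<^sub>F n in sequentially. \<exists>s>0. tracks \<rho> s (\<lambda>t. t *\<^sub>R e1) ((\<lambda>n. S n \<omega>) ` {0..n})"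
      by (rule walk_tracks_curve[where \<Lambda> = 1]) (auto simp: \<rho> e1_def simp flip: scaleR_diff_left)
    then show ?thesis
    proof (rule AE_mp, intro AE_I2 impI)
      fix \<omega> assume "\<exists>\<^sub>F n in sequentially. \<exists>s>0. tracks \<rho> s (\<lambda>t. t *\<^sub>R e1) ((\<lambda>n. S n \<omega>) ` {0..n})"
      then show "\<exists>\<^sub>F n in sequentially. 0 < diameter (?K n \<omega>) \<and> ?r n \<omega> \<le> 2 + 1 / Suc i"
      proof (rule frequently_elim1)
        fix n assume "\<exists>s>0. tracks \<rho> s (\<lambda>t. t *\<^sub>R e1) ((\<lambda>n. S n \<omega>) ` {0..n})"
        then obtain s where s: "0 < s" "tracks \<rho> s (\<lambda>t. t *\<^sub>R e1) ((\<lambda>n. S n \<omega>) ` {0..n})" by blast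
        have "norm e1 = 1" by (simp add: e1_def)
        from ratio_near_segment[OF _ s(2) this s(1) \<rho>(2)]
        show "0 < diameter (?K n \<omega>) \<and> ?r n \<omega> \<le> 2 + 1 / Suc i"
          unfolding hull using \<rho>(3) by auto
      qed
    qed
  qed
  have round: "AE \<omega> in M. \<exists>\<^sub>F n in sequentially. pi - 1 / Suc i \<le> ?r n \<omega>" for i
  proof -
    let ?\<gamma> = "\<lambda>t. direction (2 * pi * t) - direction 0"
    obtain \<rho> where \<rho>: "0 < \<rho>" "\<rho> < 1" "pi - 1 / Suc i \<le> pi * (1 - \<rho>) / (1 + \<rho>)"
      using circle_ratio_near_pi[of "pi - 1 / Suc i"] by auto
    have "AE \<omega> in M. \<exists>\<^sub>F n in sequentially. \<exists>s>0. tracks \<rho> s ?\<gamma> ((\<lambda>n. S n \<omega>) ` {0..n})"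
    proof (rule walk_tracks_curve[where \<Lambda> = "4 * pi"])
      fix t u :: real
      have "\<bar>2 * pi * t - 2 * pi * u\<bar> = 2 * pi * \<bar>t - u\<bar>"
        by (simp add: abs_mult flip: right_diff_distrib)
      then show "norm (?\<gamma> t - ?\<gamma> u) \<le> 4 * pi * \<bar>t - u\<bar>"
        using norm_direction_diff_le[of "2 * pi * t" "2 * pi * u"] by simp
    qed (auto simp: \<rho>)
    then show ?thesis
    proof (rule AE_mp, intro AE_I2 impI)
      fix \<omega> assume "\<exists>\<^sub>F n in sequentially. \<exists>s>0. tracks \<rho> s ?\<gamma> ((\<lambda>n. S n \<omega>) ` {0..n})"
      then show "\<exists>\<^sub>F n in sequentially. pi - 1 / Suc i \<le> ?r n \<omega>"
      proof (rule frequently_elim1)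
        fix n assume "\<exists>s>0. tracks \<rho> s ?\<gamma> ((\<lambda>n. S n \<omega>) ` {0..n})"
        then obtain s where s: "0 < s" "tracks \<rho> s ?\<gamma> ((\<lambda>n. S n \<omega>) ` {0..n})" by blast
        from ratio_near_circle[OF _ s(2) s(1) \<rho>(2)]
        show "pi - 1 / Suc i \<le> ?r n \<omega>"
          unfolding hull using \<rho>(3) by auto
      qed
    qed
  qed
  have "AE \<omega> in M. \<forall>i. (\<exists>\<^sub>F n in sequentially. 0 < diameter (?K n \<omega>) \<and> ?r n \<omega> \<le> 2 + 1 / Suc i) \<and>
      (\<exists>\<^sub>F n in sequentially. pi - 1 / Suc i \<le> ?r n \<omega>)"
    using thin round by (simp add: AE_all_countable)
  then show ?thesis
  proof (rule AE_mp, intro AE_I2 impI)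
    fix \<omega>
    assume all: "\<forall>i. (\<exists>\<^sub>F n in sequentially. 0 < diameter (?K n \<omega>) \<and> ?r n \<omega> \<le> 2 + 1 / Suc i) \<and>
      (\<exists>\<^sub>F n in sequentially. pi - 1 / Suc i \<le> ?r n \<omega>)"
    let ?f = "\<lambda>n. ereal (?r n \<omega>)"
    \<comment> \<open>The hulls grow, so the ratio is a genuine quotient from some time on.\<close>
    obtain n0 where n0: "0 < diameter (?K n0 \<omega>)"
      using all by (metis (mono_tags, lifting) frequently_ex)
    have diam: "0 < diameter (?K n \<omega>)" if "n0 \<le> n" for n
    proof -
      have "?K n0 \<omega> \<subseteq> ?K n \<omega>" unfolding hull using that by (intro hull_mono image_mono) auto
      then have "diameter (?K n0 \<omega>) \<le> diameter (?K n \<omega>)"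
        using poly by (intro diameter_subset polytope_imp_bounded)
      then show ?thesis using n0 by linarith
    qed
    have "\<forall>\<^sub>F n in sequentially. 2 \<le> ?f n"
      using eventually_ge_at_top[of n0]
    proof eventually_elim
      case (elim n)
      then show ?case
        using two_diameter_le_perimeter[OF poly, of n \<omega>] diam[of n] by (simp add: field_simps)
    qed
    then have "2 \<le> liminf ?f" by (rule Liminf_bounded)
    moreover have "liminf ?f \<le> 2"
    proof (rule liminf_le_if_frequently)
      fix b :: ereal assume "2 < b"
      then obtain i where i: "ereal (2 + 1 / Suc i) \<le> b"
      proof (cases b)
        case (real b')
        then have "0 < b' - 2" using \<open>2 < b\<close> by simp
        then obtain i where "1 / Suc i < b' - 2" using nat_approx_posE by blast
        then show ?thesis using that[of i] real by simp
      qed auto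
      show "\<exists>\<^sub>F n in sequentially. ?f n \<le> b"
      proof (rule frequently_elim1)
        show "\<exists>\<^sub>F n in sequentially. 0 < diameter (?K n \<omega>) \<and> ?r n \<omega> \<le> 2 + 1 / Suc i"
          using all by blast
        fix n assume "0 < diameter (?K n \<omega>) \<and> ?r n \<omega> \<le> 2 + 1 / Suc i"
        then have "?f n \<le> ereal (2 + 1 / Suc i)" by simp
        then show "?f n \<le> b" using i by (rule order_trans)
      qed
    qed
    moreover have "limsup ?f \<le> ereal pi"
    proof (rule Limsup_bounded, rule eventually_mono[OF eventually_ge_at_top[of n0]])
      fix n assume "n0 \<le> n"
      then show "?f n \<le> ereal pi"
        using perimeter_le_pi_diameter[OF poly, of n \<omega>] diam[of n] by (simp add: field_simps)
    qed
    moreover have "ereal pi \<le> limsup ?f"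
    proof (rule le_limsup_if_frequently)
      fix b :: ereal assume "b < ereal pi"
      then obtain i where i: "b \<le> ereal (pi - 1 / Suc i)"
      proof (cases b)
        case (real b')
        then have "0 < pi - b'" using \<open>b < ereal pi\<close> by simp
        then obtain i where "1 / Suc i < pi - b'" using nat_approx_posE by blast
        then show ?thesis using that[of i] real by simp
      qed auto
      show "\<exists>\<^sub>F n in sequentially. b \<le> ?f n"
      proof (rule frequently_elim1)
        show "\<exists>\<^sub>F n in sequentially. pi - 1 / Suc i \<le> ?r n \<omega>" using all by blast
        fix n assume "pi - 1 / Suc i \<le> ?r n \<omega>"
        then have "ereal (pi - 1 / Suc i) \<le> ?f n" by simp
        with i show "b \<le> ?f n" by (rule order_trans)
      qed
    qed
    ultimately have "liminf ?f = 2" "limsup ?f = ereal pi" by auto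
    then show "2 = liminf ?f \<and> liminf ?f < limsup ?f \<and> limsup ?f = ereal pi"
      using pi_gt3 by (simp add: numeral_eq_ereal)
  qed
qed

end
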